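(* Let $q$ be a prime power and let $n,k,t$ be positive integers with $t\leq k-2$ and $2k+t+\min\{4,2t\}\leq n$. Let $V$ be an $n$-dimensional vector space over $\mathbb{F}_q$. Then for any non-trivial $t$-intersecting family $\mathcal{F}\subseteq{V\brack k}$ the following hold: (i) if $1\leq t\leq\frac{k}{2}-1$, then $$|\mathcal{F}|\leq{n-t\brack k-t}-q^{(k+1-t)(k-t)}{n-k-1\brack k-t}+q^{k+1-t}{t\brack 1},$$ and equality holds if and only if $\mathcal{F}=\mathcal{H}_1(X,M)$ for some $t$-subspace $X$ and $(k+1)$-subspace $M$ of $V$ with $X\subset M$; (ii) if $\frac{k}{2}-1<t\leq k-2$, then $$|\mathcal{F}|\leq{t+2\brack 1}{n-t-1\brack k-t-1}-q{t+1\brack 1}{n-t-2\brack k-t-2},$$ and equality holds if and only if $\mathcal{F}=\mathcal{H}_3(Z)$ for some $(t+2)$-subspace $Z$ of $V$, or $(t,k)=(1,3)$ and $\mathcal{F}=\mathcal{H}_1(X,M)$ for some $1$-subspace $X$ and $4$-subspace $M$ of $V$ with $X\subset M$.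
   Context: ${V\brack k}$ denotes the set of all $k$-dimensional subspaces ("$k$-subspaces") of $V$. Gaussian binomial coefficients: ${a\brack b}=\prod_{0\leq i<b}\frac{q^{a-i}-1}{q^{b-i}-1}$ for $b\ge 1$, ${a\brack 0}=1$, and ${a\brack c}=0$ for $c<0$. A family $\mathcal{F}\subseteq{V\brack k}$ is $t$-intersecting if $\dim(A\cap B)\geq t$ for all $A,B\in\mathcal{F}$. A $t$-intersecting family is trivial if all its members contain a common $t$-subspace of $V$, and non-trivial otherwise. For subspaces $X\subseteq M$ of $V$ with $\dim X=t$ and $\dim M=k+1$, define $\mathcal{H}_1(X,M)=\{F\in{V\brack k}\mid X\subseteq F,\ \dim(F\cap M)\geq t+1\}\cup{M\brack k}$. For a $(t+2)$-subspace $Z$ of $V$, define $\mathcal{H}_3(Z)=\{F\in{V\brack k}\mid\dim(F\cap Z)\geq t+1\}$. *)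

theory Defs
  imports Complex_Main "HOL-Library.Cardinality"
begin

text \<open>Integer arguments, so that no difference in the arguments is truncated.\<close>

definition gauss_binomial :: "nat \<Rightarrow> int \<Rightarrow> int \<Rightarrow> real" where
  "gauss_binomial q a b =
     (if b < 0 then 0
      else (\<Prod>i<nat b. (real q powi (a - int i) - 1) / (real q powi (b - int i) - 1)))"

text \<open>The definitions below take the scalar multiplication of the ambient vector space explicitly
  and are meaningful under \<^term>\<open>vector_space scale\<close>.  Note that \<^const>\<open>vector_space.dim\<close> is 0 on
  infinite-dimensional sets, so \<open>V\<close> is always meant to be finite-dimensional.\<close>

definition subspaces_of_dim ::
    "('k::field \<Rightarrow> 'v::ab_group_add \<Rightarrow> 'v) \<Rightarrow> 'v set \<Rightarrow> nat \<Rightarrow> 'v set set" where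
  "subspaces_of_dim scale V k =
     {A. module.subspace scale A \<and> A \<subseteq> V \<and> vector_space.dim scale A = k}"

definition t_intersecting ::
    "('k::field \<Rightarrow> 'v::ab_group_add \<Rightarrow> 'v) \<Rightarrow> nat \<Rightarrow> 'v set set \<Rightarrow> bool" where
  "t_intersecting scale t \<F> \<longleftrightarrow> (\<forall>A\<in>\<F>. \<forall>B\<in>\<F>. t \<le> vector_space.dim scale (A \<inter> B))"

definition trivial_family ::
    "('k::field \<Rightarrow> 'v::ab_group_add \<Rightarrow> 'v) \<Rightarrow> 'v set \<Rightarrow> nat \<Rightarrow> 'v set set \<Rightarrow> bool" where
  "trivial_family scale V t \<F> \<longleftrightarrow> (\<exists>T\<in>subspaces_of_dim scale V t. \<forall>A\<in>\<F>. T \<subseteq> A)"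

text \<open>In \<open>H1\<close> and \<open>H3\<close> the intended dimensions are \<open>dim X = t\<close>, \<open>dim M = k + 1\<close>
  and \<open>dim Z = t + 2\<close>.\<close>

definition H1 ::
    "('k::field \<Rightarrow> 'v::ab_group_add \<Rightarrow> 'v) \<Rightarrow> 'v set \<Rightarrow> nat \<Rightarrow> nat \<Rightarrow> 'v set \<Rightarrow> 'v set \<Rightarrow> 'v set set" where
  "H1 scale V k t X M =
     {F \<in> subspaces_of_dim scale V k. X \<subseteq> F \<and> t + 1 \<le> vector_space.dim scale (F \<inter> M)}
     \<union> subspaces_of_dim scale M k"

definition H3 ::
    "('k::field \<Rightarrow> 'v::ab_group_add \<Rightarrow> 'v) \<Rightarrow> 'v set \<Rightarrow> nat \<Rightarrow> nat \<Rightarrow> 'v set \<Rightarrow> 'v set set" where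
  "H3 scale V k t Z =
     {F \<in> subspaces_of_dim scale V k. t + 1 \<le> vector_space.dim scale (F \<inter> Z)}"

end

(* For a maximal non-trivial t-intersecting family, consider the covers: subspaces meeting every
   member in dimension at least t.  There is no cover of dimension at most t.  A subspace S that is not
   a cover has at most [k-t+1,1] extensions by one dimension such that every member through S contains
   one of them, so "being a non-cover" costs a factor [k-t+1,1] per dimension while the number of
   k-subspaces through S drops by about q^(n-k).  If the least cover dimension is t+2 or more, the family
   is therefore small.  Otherwise look at the (t+1)-dimensional covers, which pairwise meet in dimension
   at least t.  Three of them without a common t-subspace span a (t+2)-space Z, and the family lies in
   H3(Z).  If they share a t-subspace X and all members not containing X lie in one (k+1)-space M
   containing X, the family lies in H1(X,M).  If neither happens, there are too few covers and the family
   is small again.  What remains is to compare the sizes of these five configurations. *)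
theory Submission
  imports Defs
begin

section \<open>Gaussian binomial coefficients\<close>

text \<open>The two ranges of t come from leading terms. Let a and b count the k-subspaces through a
  fixed subspace of dimension t+1 and t+2. Since a > q^(n-k) b, mainly the coefficient of a matters:
  it is [k-t+1,1] for \<open>H1\<close> and [t+2,1] for \<open>H3\<close>, and these agree exactly
  at k = 2t+1. There a sharper expansion agrees in b as well, and the next term favours
  \<open>H3\<close> unless (t,k) = (1,3), where the two sizes coincide; hence the extra extremal
  family.

  The summand min{4,2t} in the bound on n is spent on families without covers of dimension t+1,
  whose bound involves [t+2,t] [k-t+1,1]^2 b.

  It suffices to show that a maximal family above the given one lies in some \<open>H1\<close> or
  \<open>H3\<close>, because a subset of equal finite size is the whole set. Maximality puts every
  k-subspace through a cover into the family, which forces (t+1)-dimensional covers to meet in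
  dimension at least t. The space M is G + X for a member G not containing X: every
  (t+1)-dimensional cover through X lies in G + X.\<close>

lemma gauss_binomial_0 [simp]: "gauss_binomial q n 0 = 1"
  by (simp add: gauss_binomial_def)

text \<open>The arguments enter only through n - i and k - i, so peeling off the factor i = 0 leaves
  the product for the smaller pair. The rule is multiplied out to avoid division.\<close>

lemma gauss_binomial_Suc:
  assumes "q \<ge> 2"
  shows "gauss_binomial q (int (Suc n)) (int (Suc k)) * (real q ^ Suc k - 1)
       = (real q ^ Suc n - 1) * gauss_binomial q (int n) (int k)"
proof -
  have "gauss_binomial q (int (Suc n)) (int (Suc k))
     = (\<Prod>i<Suc k. (real q powi (int (Suc n) - int i) - 1) / (real q powi (int (Suc k) - int i) - 1))"
    unfolding gauss_binomial_def nat_int by simp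
  also have "\<dots> = (real q ^ Suc n - 1) / (real q ^ Suc k - 1)
      * (\<Prod>i<k. (real q powi (int n - int i) - 1) / (real q powi (int k - int i) - 1))"
    unfolding prod.lessThan_Suc_shift
    by (simp only: of_nat_0 diff_zero power_int_of_nat) simp
  also have "(\<Prod>i<k. (real q powi (int n - int i) - 1) / (real q powi (int k - int i) - 1))
      = gauss_binomial q (int n) (int k)"
    by (simp add: gauss_binomial_def)
  finally have *: "gauss_binomial q (int (Suc n)) (int (Suc k))
     = (real q ^ Suc n - 1) / (real q ^ Suc k - 1) * gauss_binomial q (int n) (int k)" .
  have "real q ^ Suc k > 1" using assms by (intro one_less_power) auto
  then show ?thesis unfolding * by simp
qed

locale gauss =
  fixes q :: nat
  assumes q_ge_2: "2 \<le> q"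
begin

abbreviation gb :: "nat \<Rightarrow> nat \<Rightarrow> real" where
  "gb n k \<equiv> gauss_binomial q (int n) (int k)"

lemmas gb_Suc = gauss_binomial_Suc[OF q_ge_2]

lemma q_power_gt_1: "real q ^ Suc n > 1"
  using q_ge_2 by (intro one_less_power) auto

lemma gb_1: "gb n 1 * (real q - 1) = real q ^ n - 1"
proof (cases n)
  case 0
  then show ?thesis by (simp add: gauss_binomial_def)
next
  case (Suc m)
  then show ?thesis using gb_Suc[of m 0] by simp
qed

text \<open>The factor with i = n is q^0 - 1 = 0.\<close>

lemma gb_eq_0: assumes "n < k" shows "gb n k = 0"
proof -
  have "(\<Prod>i<k. (real q powi (int n - int i) - 1) / (real q powi (int k - int i) - 1)) = 0"
    using assms by (intro prod_zero bexI[of _ n]) auto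
  then show ?thesis unfolding gauss_binomial_def nat_int by simp
qed

lemma gb_nonneg: "0 \<le> gb n k"
proof (induction k arbitrary: n)
  case (Suc k)
  show ?case
  proof (cases n)
    case 0
    then show ?thesis using gb_eq_0[of 0 "Suc k"] by simp
  next
    case (Suc m)
    have "0 \<le> gb (Suc m) (Suc k) * (real q ^ Suc k - 1)"
      unfolding gb_Suc using Suc.IH q_power_gt_1[of m] by (simp add: less_imp_le)
    then show ?thesis unfolding \<open>n = Suc m\<close> using q_power_gt_1[of k]
      by (metis diff_gt_0_iff_gt zero_le_mult_iff less_le_not_le)
  qed
qed simp

lemma gb_pos: "k \<le> n \<Longrightarrow> 0 < gb n k"
proof (induction k arbitrary: n)
  case (Suc k)
  then obtain m where m: "n = Suc m" "k \<le> m" by (metis Suc_le_D Suc_le_mono)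
  have "0 < gb (Suc m) (Suc k) * (real q ^ Suc k - 1)"
    unfolding gb_Suc using Suc.IH[OF m(2)] q_power_gt_1[of m] by simp
  then show ?case unfolding m using q_power_gt_1[of k]
    by (metis diff_gt_0_iff_gt zero_less_mult_pos2)
qed simp

lemma gb_1_Suc: "gb (Suc n) 1 = real q * gb n 1 + 1"
proof -
  have "(real q - 1) * gb (Suc n) 1 = (real q - 1) * (real q * gb n 1 + 1)"
    using gb_1[of n] gb_1[of "Suc n"] by (simp add: algebra_simps)
  then show ?thesis using q_ge_2 by simp
qed

text \<open>Duality of hyperplanes and lines, derived here from the absorption rule because no
  subspaces are available yet.\<close>

lemma gb_hyperplanes: "gb (Suc n) n = gb (Suc n) 1"
proof (induction n)
  case 0
  show ?case using gb_1[of 1] q_ge_2 by simp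
next
  case (Suc n)
  have q0: "real q ^ Suc n - 1 \<noteq> 0" "real q - 1 \<noteq> 0" using q_power_gt_1[of n] q_ge_2 by auto
  have "(real q ^ Suc n - 1) * (real q - 1) * gb (Suc (Suc n)) (Suc n)
      = (real q - 1) * ((real q ^ Suc (Suc n) - 1) * gb (Suc n) 1)"
    using gb_Suc[of "Suc n" n] Suc.IH by (simp only: mult_ac)
  also have "\<dots> = (real q ^ Suc (Suc n) - 1) * (real q ^ Suc n - 1)"
    by (simp only: gb_1[of "Suc n", symmetric] mult_ac)
  also have "\<dots> = (real q ^ Suc n - 1) * (real q - 1) * gb (Suc (Suc n)) 1"
    by (simp only: gb_1[of "Suc (Suc n)", symmetric] mult_ac)
  finally show ?case using q0 by simp
qed

section \<open>q-integers, the q-Pascal rule and its iterates\<close>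

abbreviation Q :: real where "Q \<equiv> real q"

definition qint :: "nat \<Rightarrow> real" where "qint m = gb m 1"

lemma Q_ge_2: "2 \<le> Q"
  using q_ge_2 by simp

lemma qint_0 [simp]: "qint 0 = 0"
  unfolding qint_def by (rule gb_eq_0) simp

lemma qint_Suc: "qint (Suc m) = Q * qint m + 1"
  unfolding qint_def by (rule gb_1_Suc)

lemma qint_mult: "qint m * (Q - 1) = Q ^ m - 1"
  unfolding qint_def by (rule gb_1)

lemma qint_Suc': "qint (Suc m) = qint m + Q ^ m"
  using qint_mult[of m] by (simp add: qint_Suc algebra_simps)

lemma qint_sum: "qint m = (\<Sum>i<m. Q ^ i)"
  by (induction m) (simp_all add: qint_Suc')

lemma qint_mono: "i \<le> j \<Longrightarrow> qint i \<le> qint j"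
  unfolding qint_sum using Q_ge_2 by (intro sum_mono2) auto

lemma qint_nonneg: "0 \<le> qint m"
  using qint_mono[of 0 m] by simp

lemma qint_add: "qint (i + j) = qint i + Q ^ i * qint j"
  by (induction j) (simp_all add: qint_Suc' power_add algebra_simps)

text \<open>For q >= 2 a geometric sum is less than twice its top term. The -1 later absorbs
  lower-order summands in \<open>unique_size_less_h3\<close> and in the case t = 1 of
  \<open>none_size_less_h3\<close>.\<close>

lemma qint_upper: "qint (Suc m) \<le> 2 * Q ^ m - 1"
proof (induction m)
  case (Suc m)
  have "Q * qint (Suc m) \<le> Q * (2 * Q ^ m - 1)" using Suc Q_ge_2 by (intro mult_left_mono) auto
  then show ?case using Q_ge_2 by (simp add: qint_Suc[of "Suc m"] algebra_simps)
qed (simp add: qint_Suc)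

lemma qint_le_power: "qint m \<le> Q ^ m - 1"
proof (cases m)
  case (Suc j)
  have "2 * Q ^ j \<le> Q * Q ^ j" using Q_ge_2 by (intro mult_right_mono) auto
  then show ?thesis using qint_upper[of j] Suc by simp
qed simp

text \<open>Each numerical factor 2 is paid for with one power of q, so estimates reduce to
  comparing exponents.\<close>

lemma power_gap: "m + j \<le> l \<Longrightarrow> 2 ^ j * Q ^ m \<le> Q ^ l"
proof -
  assume "m + j \<le> l"
  then have "Q ^ (j + m) \<le> Q ^ l" using Q_ge_2 by (intro power_increasing) auto
  moreover have "2 ^ j * Q ^ m \<le> Q ^ j * Q ^ m" using Q_ge_2 by (intro mult_right_mono power_mono) auto
  ultimately show ?thesis by (simp add: power_add)
qed

text \<open>Companion of the absorption rule that changes only the lower argument. For r \<ge> m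
  both sides vanish, so the truncated difference does no harm.\<close>

lemma gb_Suc_right: "gb m (Suc r) * (Q ^ Suc r - 1) = (Q ^ (m - r) - 1) * gb m r"
proof (induction r arbitrary: m)
  case 0
  show ?case using gb_1[of m] by simp
next
  case (Suc r)
  show ?case
  proof (cases m)
    case 0
    have "gb 0 (Suc (Suc r)) = 0" by (rule gb_eq_0) simp
    then show ?thesis unfolding 0 by simp
  next
    case m: (Suc j)
    have "(Q ^ Suc r - 1) * (gb (Suc j) (Suc (Suc r)) * (Q ^ Suc (Suc r) - 1))
        = (Q ^ Suc j - 1) * (gb j (Suc r) * (Q ^ Suc r - 1))"
      unfolding gb_Suc by (simp only: mult_ac)
    also have "\<dots> = (Q ^ (j - r) - 1) * ((Q ^ Suc j - 1) * gb j r)"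
      unfolding Suc.IH by (simp only: mult_ac)
    also have "\<dots> = (Q ^ Suc r - 1) * ((Q ^ (j - r) - 1) * gb (Suc j) (Suc r))"
      unfolding gb_Suc[symmetric] by (simp only: mult_ac)
    finally show ?thesis using q_power_gt_1[of r] m by (simp del: of_nat_Suc)
  qed
qed

lemma gb_pascal: "gb (Suc m) (Suc r) = Q ^ Suc r * gb m (Suc r) + gb m r"
proof (cases "r \<le> m")
  case True
  have "(Q ^ Suc r - 1) * gb (Suc m) (Suc r) = (Q ^ Suc m - 1) * gb m r"
    using gb_Suc[of m r] by (simp only: mult_ac)
  also have "\<dots> = Q ^ Suc r * ((Q ^ (m - r) - 1) * gb m r) + (Q ^ Suc r - 1) * gb m r"
    using True by (simp add: algebra_simps flip: power_add)
  also have "\<dots> = (Q ^ Suc r - 1) * (Q ^ Suc r * gb m (Suc r) + gb m r)"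
    unfolding gb_Suc_right[symmetric] by (simp add: algebra_simps)
  finally show ?thesis using q_power_gt_1[of r] by (simp del: of_nat_Suc)
next
  case False
  have "gb (Suc m) (Suc r) = 0" "gb m (Suc r) = 0" "gb m r = 0" using False by (intro gb_eq_0; simp)+
  then show ?thesis by (simp only:)
qed

text \<open>The q-Pascal rule applied s times. Geometrically, the left side counts the
  (r+1)-subspaces of an N-space that meet a fixed s-space nontrivially; summand i counts those
  avoiding the i-dimensional member of a flag in that s-space but not the next member.\<close>

lemma gb_drop:
  "s \<le> N \<Longrightarrow> gb N (Suc r) - Q ^ (s * Suc r) * gb (N - s) (Suc r)
     = (\<Sum>i<s. Q ^ (i * Suc r) * gb (N - 1 - i) r)"
proof (induction s)
  case (Suc s)
  then obtain j where j: "N - s = Suc j" "N - Suc s = j" "N - 1 - s = j"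
    by (metis Suc_diff_Suc Suc_le_lessD diff_Suc_eq_diff_pred One_nat_def diff_commute)
  have "Q ^ (Suc s * Suc r) = Q ^ (s * Suc r) * Q ^ Suc r" by (simp add: power_add[symmetric] algebra_simps)
  then have "Q ^ (s * Suc r) * gb (N - s) (Suc r)
      = Q ^ (Suc s * Suc r) * gb (N - Suc s) (Suc r) + Q ^ (s * Suc r) * gb (N - 1 - s) r"
    unfolding j gb_pascal by (simp only: distrib_left mult.assoc)
  then show ?case using Suc by (simp del: of_nat_Suc mult_Suc_right)
qed simp

lemma gb_shift_le: "i \<le> M \<Longrightarrow> Q ^ (i * r) * gb (M - i) r \<le> gb M r"
proof (cases r)
  case (Suc p)
  assume "i \<le> M"
  have "0 \<le> (\<Sum>j<i. Q ^ (j * Suc p) * gb (M - 1 - j) p)"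
    using gb_nonneg by (intro sum_nonneg mult_nonneg_nonneg) auto
  then show ?thesis
    unfolding gb_drop[OF \<open>i \<le> M\<close>, of p, symmetric] Suc by (simp only: diff_ge_0_iff_ge)
qed simp

text \<open>A union bound: a (p+1)-space meeting a fixed i-space contains one of its
  \<open>qint i\<close> lines, and each line lies in \<open>gb (M - 1) p\<close> spaces.\<close>

lemma gb_shift_ge:
  assumes "i \<le> M"
  shows "gb M (Suc p) - qint i * gb (M - 1) p \<le> Q ^ (i * Suc p) * gb (M - i) (Suc p)"
proof -
  have "(\<Sum>j<i. Q ^ (j * Suc p) * gb (M - 1 - j) p) \<le> (\<Sum>j<i. Q ^ j * gb (M - 1) p)"
  proof (rule sum_mono)
    fix j assume "j \<in> {..<i}"
    then have "Q ^ j * (Q ^ (j * p) * gb (M - 1 - j) p) \<le> Q ^ j * gb (M - 1) p"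
      using gb_shift_le[of j "M - 1" p] assms Q_ge_2 by (intro mult_left_mono) auto
    then show "Q ^ (j * Suc p) * gb (M - 1 - j) p \<le> Q ^ j * gb (M - 1) p"
      by (simp add: power_add)
  qed
  also have "\<dots> = qint i * gb (M - 1) p" by (simp add: qint_sum sum_distrib_right)
  finally show ?thesis using gb_drop[OF assms, of p] by linarith
qed

lemma gb_ge_1: "r \<le> m \<Longrightarrow> 1 \<le> gb m r"
proof (induction r arbitrary: m)
  case (Suc r)
  then obtain j where j: "m = Suc j" "r \<le> j" by (metis Suc_le_D Suc_le_mono)
  have "1 \<le> gb j r" using Suc.IH j by simp
  moreover have "0 \<le> Q ^ Suc r * gb j (Suc r)"
    by (intro mult_nonneg_nonneg gb_nonneg) simp
  ultimately have "0 \<le> Q ^ Suc r * gb j (Suc r) \<and> 1 \<le> gb j r" by blast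
  then show ?case unfolding j gb_pascal by linarith
qed simp

lemma gb_gt_1: "Suc r < m \<Longrightarrow> 1 < gb m (Suc r)"
proof -
  assume a: "Suc r < m"
  then obtain j where j: "m = Suc j" "Suc r \<le> j" by (metis less_imp_Suc_add le_add1 less_Suc_eq_le)
  have "1 \<le> gb j r" "0 < Q ^ Suc r * gb j (Suc r)" using j gb_ge_1[of r j] gb_pos[of "Suc r" j] q_ge_2 by auto
  then show ?thesis unfolding j gb_pascal by linarith
qed

end

section \<open>Comparison of the sizes\<close>

text \<open>Here \<open>k = t + p + 2\<close> and \<open>n = k + l\<close>; \<open>a\<close> and \<open>b\<close> count the \<open>k\<close>-subspaces through a fixed
  subspace of dimension \<open>t + 1\<close> and \<open>t + 2\<close>, and \<open>h1\<close> and \<open>h3\<close> are the sizes of the two extremal families.\<close>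
locale size_bounds = gauss +
  fixes t p l :: nat
  assumes t_pos: "0 < t" and l_ge: "p + 2 + 2 * t + min 4 (2 * t) \<le> l"
begin

definition a :: real where "a = gb (p + 1 + l) (p + 1)"
definition b :: real where "b = gb (p + l) p"
definition h1 :: real where
  "h1 = gb (p + 2 + l) (p + 2) - Q ^ ((p + 3) * (p + 2)) * gb (l - 1) (p + 2) + Q ^ (p + 3) * qint t"
definition h3 :: real where "h3 = qint (t + 2) * a - Q * qint (t + 1) * b"

lemma b_ge_1: "1 \<le> b"
  unfolding b_def by (rule gb_ge_1) simp

text \<open>The ratio a/b is exactly (Q^(p+1+l) - 1)/(Q^(p+1) - 1), and this exceeds Q^l as l > 0. A
  comparison is therefore won once the coefficient of \<open>b\<close> is at most Q^l times that of
  \<open>a\<close>.\<close>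

lemma a_gt: "Q ^ l * b < a"
proof -
  have e: "a * (Q ^ Suc p - 1) = (Q ^ Suc (p + l) - 1) * b"
    using gb_Suc[of "p + l" p] unfolding a_def b_def by simp
  have "1 < Q ^ l" using Q_ge_2 l_ge by (intro one_less_power) auto
  then have "Q ^ l * (Q ^ Suc p - 1) < Q ^ Suc (p + l) - 1"
    by (simp add: algebra_simps power_add)
  then have "Q ^ l * (Q ^ Suc p - 1) * b < (Q ^ Suc (p + l) - 1) * b"
    using b_ge_1 by (intro mult_strict_right_mono) auto
  then have "(Q ^ l * b) * (Q ^ Suc p - 1) < a * (Q ^ Suc p - 1)"
    using e by (simp add: mult_ac)
  then show ?thesis using q_power_gt_1[of p] by (simp add: mult_less_cancel_right)
qed

text \<open>The bracket in summand i counts (p+1)-spaces avoiding an i-space, so it lies between a -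
  \<open>qint i\<close> b and a. The estimates of \<open>h1\<close> below all start from this
  form.\<close>

lemma h1_sum: "h1 = (\<Sum>i<p + 3. Q ^ i * (Q ^ (i * (p + 1)) * gb (p + 1 + l - i) (p + 1))) + Q ^ (p + 3) * qint t"
proof -
  have "p + 3 \<le> p + 2 + l" using l_ge by simp
  from gb_drop[OF this, of "p + 1"]
  have "gb (p + 2 + l) (p + 2) - Q ^ ((p + 3) * (p + 2)) * gb (l - 1) (p + 2)
      = (\<Sum>i<p + 3. Q ^ (i * (p + 2)) * gb (p + 1 + l - i) (p + 1))" by (simp add: numeral_eq_Suc)
  then show ?thesis unfolding h1_def by (simp add: power_add mult.assoc)
qed

lemma h1_ge: "qint (p + 3) * a - (\<Sum>i<p + 3. Q ^ i * qint i) * b + Q ^ (p + 3) * qint t \<le> h1"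
proof -
  have "qint (p + 3) * a - (\<Sum>i<p + 3. Q ^ i * qint i) * b = (\<Sum>i<p + 3. Q ^ i * (a - qint i * b))"
    by (simp add: qint_sum sum_distrib_right sum_subtractf right_diff_distrib mult.assoc)
  also have "\<dots> \<le> (\<Sum>i<p + 3. Q ^ i * (Q ^ (i * (p + 1)) * gb (p + 1 + l - i) (p + 1)))"
  proof (intro sum_mono mult_left_mono)
    fix i assume "i \<in> {..<p + 3}"
    then have "i \<le> p + 1 + l" using l_ge by simp
    from gb_shift_ge[OF this, of p] show "a - qint i * b \<le> Q ^ (i * (p + 1)) * gb (p + 1 + l - i) (p + 1)"
      unfolding a_def b_def by simp
  qed (use Q_ge_2 in simp)
  finally show ?thesis unfolding h1_sum by simp
qed

lemma h1_le: "h1 \<le> qint (p + 3) * a + Q ^ (p + 3) * qint t"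
proof -
  have "(\<Sum>i<p + 3. Q ^ i * (Q ^ (i * (p + 1)) * gb (p + 1 + l - i) (p + 1))) \<le> (\<Sum>i<p + 3. Q ^ i * a)"
  proof (intro sum_mono mult_left_mono)
    fix i assume "i \<in> {..<p + 3}"
    then have "i \<le> p + 1 + l" using l_ge by simp
    from gb_shift_le[OF this, of "p + 1"] show "Q ^ (i * (p + 1)) * gb (p + 1 + l - i) (p + 1) \<le> a"
      unfolding a_def .
  qed (use Q_ge_2 in simp)
  then show ?thesis unfolding h1_sum by (simp add: qint_sum sum_distrib_right)
qed

text \<open>At k = 2t+1 the coefficients of \<open>a\<close> in \<open>h1\<close> and
  \<open>h3\<close> coincide and \<open>h1_le\<close> is too weak. Here the drop below
  \<open>a\<close> is kept exactly for i = 1, and to two terms for every i \<ge> 2.\<close>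

lemma h1_le_sharp:
  "h1 \<le> qint (p + 3) * a - Q * qint (p + 2) * b - Q ^ 2 * qint (p + 1) * (Q ^ (p + 1) * gb (p + l - 1) p)
     + Q ^ (p + 3) * qint t"
proof -
  let ?c = "gb (p + l - 1) p"
  let ?f = "\<lambda>i. Q ^ (i * (p + 1)) * gb (p + 1 + l - i) (p + 1)"
  have drop: "a - ?f i = (\<Sum>j<i. Q ^ (j * Suc p) * gb (p + l - j) p)" if "i < p + 3" for i
    using gb_drop[of i "p + 1 + l" p] that l_ge unfolding a_def by simp
  have f0: "?f 0 = a" unfolding a_def by simp
  have f1: "?f 1 = a - b" using drop[of 1] unfolding b_def by simp
  have f2: "?f (i + 2) \<le> a - b - Q ^ (p + 1) * ?c" if "i < p + 1" for i
  proof -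
    have "(\<Sum>j<2. Q ^ (j * Suc p) * gb (p + l - j) p) \<le> (\<Sum>j<i + 2. Q ^ (j * Suc p) * gb (p + l - j) p)"
      using gb_nonneg by (intro sum_mono2) auto
    then show ?thesis using drop[of "i + 2"] that unfolding b_def by (simp add: numeral_2_eq_2)
  qed
  have geom: "(\<Sum>i<p + 1. Q ^ (i + 2) * d) = Q ^ 2 * qint (p + 1) * d" for d
    unfolding qint_sum sum_distrib_left sum_distrib_right power_add by (simp only: mult_ac)
  have "(\<Sum>i<p + 3. Q ^ i * ?f i) = ?f 0 + Q * ?f 1 + (\<Sum>i<p + 1. Q ^ (i + 2) * ?f (i + 2))"
    by (simp add: numeral_3_eq_3 sum.lessThan_Suc_shift del: sum.lessThan_Suc) 
  also have "\<dots> \<le> a + Q * (a - b) + (\<Sum>i<p + 1. Q ^ (i + 2) * (a - b - Q ^ (p + 1) * ?c))"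
    unfolding f0 f1 using f2 Q_ge_2 by (intro add_left_mono sum_mono mult_left_mono) auto
  also have "(\<Sum>i<p + 1. Q ^ (i + 2) * (a - b - Q ^ (p + 1) * ?c))
      = Q ^ 2 * qint (p + 1) * (a - b - Q ^ (p + 1) * ?c)"
    by (rule geom)
  also have "a + Q * (a - b) + Q ^ 2 * qint (p + 1) * (a - b - Q ^ (p + 1) * ?c)
      = (1 + Q * (1 + Q * qint (p + 1))) * a - Q * (1 + Q * qint (p + 1)) * b
        - Q ^ 2 * qint (p + 1) * (Q ^ (p + 1) * ?c)"
    by (simp add: algebra_simps power2_eq_square)
  also have "1 + Q * qint (p + 1) = qint (p + 2)" using qint_Suc[of "p + 1"] by simp
  also have "1 + Q * qint (p + 2) = qint (p + 3)" using qint_Suc[of "p + 2"] by (simp add: numeral_3_eq_3)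
  finally show ?thesis unfolding h1_sum by simp
qed

section \<open>Size bounds for the families that are not extremal\<close>

definition \<theta> :: real where "\<theta> = qint (p + 3)"
definition \<mu> :: real where "\<mu> = qint (p + 2)"
text \<open>This and the next two quantities bound, respectively, a family with a single
  (t+1)-dimensional cover, a family whose (t+1)-dimensional covers share a t-space without forcing
  \<open>H1\<close>, and a family whose least cover dimension is m \<ge> t + 2.\<close>

definition unique_size :: real where "unique_size = a + qint (t + 1) * ((\<theta> - 1) * (\<theta> * b))"
definition pencil_size :: real where
  "pencil_size = \<mu> * a + (\<theta> - \<mu>) * (\<theta> * b) + (qint (t + 2) - qint 2) * (\<theta> * b)"
definition none_size :: "nat \<Rightarrow> real" where
  "none_size m = gb m t * \<theta> ^ (m - t) * gb (t + p + 2 + l - m) (t + p + 2 - m)"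

lemma mult_b_less_a: "c \<le> Q ^ l \<Longrightarrow> c * b < a"
  using a_gt b_ge_1 mult_right_mono[of c "Q ^ l" b] by linarith

lemma power_prod: "i + j = m \<Longrightarrow> Q ^ i * Q ^ j = Q ^ m"
  by (simp flip: power_add)

lemma qint_le: "qint (Suc m) \<le> 2 * Q ^ m"
  using qint_upper[of m] by simp

lemma theta_mu_bounds:
  "\<theta> = \<mu> + Q ^ (p + 2)" "\<theta> - 1 = Q * \<mu>" "1 \<le> \<mu>" "\<mu> \<le> \<theta>" "\<theta> \<le> 2 * Q ^ (p + 2) - 1" "\<mu> \<le> 2 * Q ^ (p + 1)"
  "\<mu> \<le> Q ^ (p + 2)"
proof -
  show "\<theta> = \<mu> + Q ^ (p + 2)" using qint_Suc'[of "p + 2"] unfolding \<theta>_def \<mu>_def by (simp add: numeral_eq_Suc)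
  then show "\<mu> \<le> \<theta>" by simp
  show "\<theta> - 1 = Q * \<mu>" using qint_Suc[of "p + 2"] unfolding \<theta>_def \<mu>_def by (simp add: numeral_eq_Suc)
  show "1 \<le> \<mu>" using qint_mono[of 1 "p + 2"] qint_Suc[of 0] unfolding \<mu>_def by simp
  show "\<theta> \<le> 2 * Q ^ (p + 2) - 1" using qint_upper[of "p + 2"] unfolding \<theta>_def by (simp add: numeral_eq_Suc)
  show "\<mu> \<le> 2 * Q ^ (p + 1)" using qint_le[of "p + 1"] unfolding \<mu>_def by simp
  show "\<mu> \<le> Q ^ (p + 2)" using qint_le_power[of "p + 2"] unfolding \<mu>_def by simp
qed

text \<open>min {4, 2t} equals 2 only for t = 1. For larger t there are two more powers of q to
  spend, which is why the estimates of \<open>none_size\<close> split at t = 1.\<close>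

lemma l_gap: "p + 2 * t + 4 \<le> l" "t = 1 \<or> p + 2 * t + 6 \<le> l"
  using l_ge t_pos by (auto simp: min_def split: if_splits)

lemma qint_t_bounds:
  "qint (t + 2) = Q * qint (t + 1) + 1" "qint (t + 2) = qint (t + 1) + Q ^ (t + 1)"
  "1 \<le> qint (t + 1)" "qint (t + 1) \<le> 2 * Q ^ t" "qint (t + 2) \<le> 2 * Q ^ (t + 1)"
proof -
  show "qint (t + 2) = Q * qint (t + 1) + 1" using qint_Suc[of "t + 1"] by simp
  show "qint (t + 2) = qint (t + 1) + Q ^ (t + 1)" using qint_Suc'[of "t + 1"] by simp
  show "1 \<le> qint (t + 1)" using qint_mono[of 1 "t + 1"] qint_Suc[of 0] by simp
  show "qint (t + 1) \<le> 2 * Q ^ t" using qint_le[of t] by simp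
  show "qint (t + 2) \<le> 2 * Q ^ (t + 1)" using qint_le[of "t + 1"] by simp
qed

lemma b_less_a: "b < a"
  using mult_b_less_a[of 1] Q_ge_2 by (simp add: one_le_power)

text \<open>Raising m by one multiplies the bound by (Q^(m+1) - 1)/(Q^(m-t+1) - 1), which is at most
  2 Q^t, by \<open>\<theta>\<close>, and by a factor of at most Q^(-l). Since 4 Q^(t+p+2) \<le> Q^l
  the product is at most 1, and only m = t + 2 has to be examined.\<close>

lemma none_size_mono:
  assumes "t + 2 \<le> m" "m < t + p + 2"
  shows "none_size (Suc m) \<le> none_size m"
proof -
  define j where "j = m - t"
  define i where "i = t + p + 1 - m"
  have mj: "m = t + j" "m - t = j" "Suc m - t = Suc j" and i: "t + p + 2 - m = Suc i" "t + p + 2 - Suc m = i"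
    "t + p + 2 + l - m = Suc (i + l)" "t + p + 2 + l - Suc m = i + l"
    using assms unfolding j_def i_def by auto
  have g1: "gb (Suc m) t * (Q ^ Suc j - 1) = (Q ^ Suc m - 1) * gb m t"
  proof -
    obtain u where u: "t = Suc u" using t_pos by (cases t) auto
    have ju: "m - u = Suc j" using mj u by simp
    have "(Q ^ Suc u - 1) * (gb (Suc m) t * (Q ^ Suc j - 1)) = (Q ^ Suc j - 1) * (gb (Suc m) (Suc u) * (Q ^ Suc u - 1))"
      unfolding u by (simp only: mult_ac)
    also have "\<dots> = (Q ^ Suc m - 1) * ((Q ^ Suc j - 1) * gb m u)"
      unfolding gb_Suc by (simp only: mult_ac)
    also have "\<dots> = (Q ^ Suc u - 1) * ((Q ^ Suc m - 1) * gb m t)"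
      unfolding gb_Suc_right[of m u, unfolded ju, symmetric] u by (simp only: mult_ac)
    finally show ?thesis using q_power_gt_1[of u] by (simp del: of_nat_Suc)
  qed
  have g2: "gb (Suc (i + l)) (Suc i) * (Q ^ Suc i - 1) = (Q ^ Suc (i + l) - 1) * gb (i + l) i"
    by (rule gb_Suc)
  have pos: "0 < Q ^ Suc j - 1" "0 < Q ^ Suc i - 1" "0 < Q ^ Suc (i + l) - 1"
    using q_power_gt_1 by simp_all
  have c1: "Q ^ Suc m - 1 \<le> 2 * Q ^ t * (Q ^ Suc j - 1)"
  proof -
    have "2 * Q ^ t \<le> Q ^ Suc m" using power_gap[of t 1 "Suc m"] assms by simp
    moreover have "Q ^ Suc m = Q ^ t * Q ^ Suc j" using mj by (simp add: power_add)
    moreover have "2 * Q ^ t * (Q ^ Suc j - 1) = 2 * (Q ^ t * Q ^ Suc j) - 2 * Q ^ t"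
      by (simp only: right_diff_distrib mult_1_right mult.assoc)
    ultimately show ?thesis by linarith
  qed
  have c2: "Q ^ l * (Q ^ Suc i - 1) \<le> Q ^ Suc (i + l) - 1"
  proof -
    have "1 \<le> Q ^ l" using Q_ge_2 by (simp add: one_le_power)
    then show ?thesis by (simp add: algebra_simps power_add)
  qed
  have c3: "2 * Q ^ t * \<theta> \<le> Q ^ l"
  proof -
    have "2 * Q ^ t * \<theta> \<le> 2 * Q ^ t * (2 * Q ^ (p + 2))"
      using theta_mu_bounds by (intro mult_left_mono) auto
    also have "\<dots> = 2 ^ 2 * Q ^ (t + p + 2)" by (simp add: power_add)
    also have "\<dots> \<le> Q ^ l" using l_gap(1) t_pos by (intro power_gap) simp
    finally show ?thesis .
  qed
  have th0: "0 \<le> \<theta>" using theta_mu_bounds by linarith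
  have "((Q ^ Suc m - 1) * \<theta>) * (Q ^ Suc i - 1) \<le> (2 * Q ^ t * (Q ^ Suc j - 1) * \<theta>) * (Q ^ Suc i - 1)"
    using c1 th0 pos by (intro mult_right_mono) auto
  also have "\<dots> = (2 * Q ^ t * \<theta>) * ((Q ^ Suc j - 1) * (Q ^ Suc i - 1))" by (simp only: mult_ac)
  also have "\<dots> \<le> Q ^ l * ((Q ^ Suc j - 1) * (Q ^ Suc i - 1))"
    using c3 pos by (intro mult_right_mono) auto
  also have "\<dots> = (Q ^ Suc j - 1) * (Q ^ l * (Q ^ Suc i - 1))" by (simp only: mult_ac)
  also have "\<dots> \<le> (Q ^ Suc j - 1) * (Q ^ Suc (i + l) - 1)"
    using c2 pos by (intro mult_left_mono) auto
  finally have key: "((Q ^ Suc m - 1) * \<theta>) * (Q ^ Suc i - 1) \<le> (Q ^ Suc j - 1) * (Q ^ Suc (i + l) - 1)" .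
  let ?c = "gb m t * \<theta> ^ j * gb (i + l) i"
  have c0: "0 \<le> ?c" by (intro mult_nonneg_nonneg gb_nonneg zero_le_power th0)
  have "none_size (Suc m) * ((Q ^ Suc j - 1) * (Q ^ Suc i - 1))
      = (gb (Suc m) t * (Q ^ Suc j - 1)) * \<theta> ^ Suc j * gb (i + l) i * (Q ^ Suc i - 1)"
    unfolding none_size_def mj(3) i by (simp only: mult_ac)
  also have "\<dots> = ((Q ^ Suc m - 1) * \<theta>) * (Q ^ Suc i - 1) * ?c"
    unfolding g1 power_Suc[of \<theta>] by (simp only: mult_ac)
  also have "\<dots> \<le> (Q ^ Suc j - 1) * (Q ^ Suc (i + l) - 1) * ?c"
    using key c0 by (rule mult_right_mono)
  also have "\<dots> = gb m t * \<theta> ^ j * ((Q ^ Suc (i + l) - 1) * gb (i + l) i) * (Q ^ Suc j - 1)"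
    by (simp only: mult_ac)
  also have "\<dots> = none_size m * ((Q ^ Suc j - 1) * (Q ^ Suc i - 1))"
    unfolding g2[symmetric] none_size_def mj(2) i by (simp only: mult_ac)
  finally show ?thesis using pos by (simp add: mult_le_cancel_right del: power_Suc)
qed

lemma none_size_le:
  assumes "t + 2 \<le> m" "m \<le> t + p + 2"
  shows "none_size m \<le> none_size (t + 2)"
  using assms
proof (induction m rule: dec_induct)
  case (step m)
  then show ?case using none_size_mono[of m] by simp
qed simp

text \<open>[t+2,t] = [t+2,1] [t+1,1] / (q+1). Leaving q+1 on the left avoids division, and for t =
  1 it cancels against [t+1,1].\<close>

lemma none_size_base: "(Q + 1) * none_size (t + 2) = qint (t + 2) * qint (t + 1) * \<theta>\<^sup>2 * b"
proof -
  have q0: "Q - 1 \<noteq> 0" using Q_ge_2 by simp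
  obtain u where u: "t = Suc u" using t_pos by (cases t) auto
  have h: "gb (Suc t) t = qint (Suc t)" unfolding qint_def by (rule gb_hyperplanes)
  have "(Q ^ Suc u - 1) * (gb (Suc (Suc t)) t * (Q ^ 2 - 1))
      = (Q ^ 2 - 1) * (gb (Suc (Suc t)) (Suc u) * (Q ^ Suc u - 1))"
    unfolding u by (simp only: mult_ac)
  also have "\<dots> = (Q ^ Suc (Suc t) - 1) * ((Q ^ 2 - 1) * gb (Suc t) u)"
    unfolding gb_Suc by (simp only: mult_ac)
  also have "2 = Suc t - u" using u by simp
  also have "(Q ^ Suc (Suc t) - 1) * ((Q ^ (Suc t - u) - 1) * gb (Suc t) u)
      = (Q ^ Suc u - 1) * ((Q ^ Suc (Suc t) - 1) * gb (Suc t) t)"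
    unfolding gb_Suc_right[symmetric] u by (simp only: mult_ac)
  finally have "gb (Suc (Suc t)) t * (Q ^ (Suc t - u) - 1) = (Q ^ Suc (Suc t) - 1) * qint (Suc t)"
    using q_power_gt_1[of u] h by (simp del: of_nat_Suc)
  also have "Suc t - u = 2" using u by simp
  also have "Q ^ 2 - 1 = (Q + 1) * (Q - 1)" by (simp add: algebra_simps power2_eq_square)
  also have "Q ^ Suc (Suc t) - 1 = qint (Suc (Suc t)) * (Q - 1)" by (simp only: qint_mult)
  finally have "(Q - 1) * ((Q + 1) * gb (Suc (Suc t)) t) = (Q - 1) * (qint (Suc (Suc t)) * qint (Suc t))"
    by (simp only: mult_ac)
  then have "(Q + 1) * gb (Suc (Suc t)) t = qint (Suc (Suc t)) * qint (Suc t)" using q0 by (simp del: of_nat_Suc)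
  moreover have "none_size (t + 2) = gb (Suc (Suc t)) t * \<theta>\<^sup>2 * b"
    unfolding none_size_def b_def by simp
  ultimately show ?thesis by (simp only: mult.assoc[symmetric]) simp
qed

subsection \<open>The range \<open>k \<ge> 2 t + 2\<close>\<close>

text \<open>Every i in \<open>h1_ge\<close> is at most p + 2, so \<open>\<mu>\<close> replaces each
  \<open>qint i\<close>, and the positive last summand is dropped. In this range such a loss in the
  coefficient of \<open>b\<close> is affordable.\<close>

lemma h1_ge_crude: "\<theta> * a - \<mu> * \<theta> * b \<le> h1"
proof -
  have "(\<Sum>i<p + 3. Q ^ i * qint i) \<le> (\<Sum>i<p + 3. Q ^ i * \<mu>)"
    unfolding \<mu>_def using Q_ge_2 by (intro sum_mono mult_left_mono qint_mono) auto
  also have "\<dots> = \<mu> * \<theta>" by (simp add: \<theta>_def qint_sum sum_distrib_left mult.commute)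
  finally have "(\<Sum>i<p + 3. Q ^ i * qint i) * b \<le> \<mu> * \<theta> * b"
    using b_ge_1 by (intro mult_right_mono) auto
  moreover have "0 \<le> Q ^ (p + 3) * qint t" using qint_nonneg by simp
  ultimately show ?thesis using h1_ge unfolding \<theta>_def by linarith
qed

lemma mu_theta: "\<mu> * \<theta> \<le> 2 ^ 2 * Q ^ (p + 1) * Q ^ (p + 2)"
proof -
  have "\<mu> * \<theta> \<le> (2 * Q ^ (p + 1)) * (2 * Q ^ (p + 2))"
    using theta_mu_bounds by (intro mult_mono) auto
  then show ?thesis by simp
qed

context
  assumes large: "t \<le> p"
begin

text \<open>Since t \<le> p, the leading coefficient of \<open>h3\<close> is at most
  \<open>\<mu>\<close>, whereas that of \<open>h1\<close> is \<open>\<theta>\<close> =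
  \<open>\<mu>\<close> + Q^(p+2). The surplus Q^(p+2) a outweighs the loss
  \<open>\<mu> * \<theta> * b\<close>.\<close>

lemma h3_less_h1: "h3 < h1"
proof -
  have a0: "0 < a" using b_less_a b_ge_1 by linarith
  have "qint (t + 2) \<le> \<mu>" unfolding \<mu>_def using large by (intro qint_mono) simp
  then have "qint (t + 2) * a \<le> \<mu> * a" using a0 by (intro mult_right_mono) auto
  moreover have "0 \<le> Q * qint (t + 1) * b" using b_ge_1 qint_nonneg by simp
  ultimately have 1: "h3 \<le> \<mu> * a" unfolding h3_def by linarith
  have "2 ^ 2 * Q ^ (p + 1) * b < a" using l_gap t_pos by (intro mult_b_less_a power_gap) simp
  then have "Q ^ (p + 2) * (2 ^ 2 * Q ^ (p + 1) * b) < Q ^ (p + 2) * a"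
    using Q_ge_2 by (intro mult_strict_left_mono) auto
  moreover have "\<mu> * \<theta> * b \<le> 2 ^ 2 * Q ^ (p + 1) * Q ^ (p + 2) * b"
    using mu_theta b_ge_1 by (intro mult_right_mono) auto
  moreover have "\<theta> * a = \<mu> * a + Q ^ (p + 2) * a" using theta_mu_bounds(1) by (simp only: distrib_right)
  ultimately show ?thesis using 1 h1_ge_crude by (simp only: mult_ac)
qed

text \<open>As \<open>\<theta>\<close> - 1 = Q \<open>\<mu>\<close>, removing one \<open>a\<close>
  from both sides leaves the common factor \<open>\<mu>\<close>. It remains to compare (1 + Q
  [t+1,1]) \<open>\<theta>\<close> b with Q a.\<close>

lemma unique_size_less_h1: "unique_size < h1"
proof -
  have "\<theta> \<le> 2 * Q ^ (t + p + 3)"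
  proof -
    have "Q ^ (p + 2) \<le> Q ^ (t + p + 3)" using Q_ge_2 by (intro power_increasing) auto
    then show ?thesis using theta_mu_bounds by linarith
  qed
  moreover have "Q * qint (t + 1) * \<theta> \<le> 4 * Q ^ (t + p + 3)"
  proof -
    have "Q * qint (t + 1) * \<theta> \<le> Q * (2 * Q ^ t) * (2 * Q ^ (p + 2))"
      using theta_mu_bounds qint_t_bounds Q_ge_2 by (intro mult_mono) auto
    also have "\<dots> = 4 * (Q ^ (t + 1) * Q ^ (p + 2))" by simp
    also have "Q ^ (t + 1) * Q ^ (p + 2) = Q ^ (t + p + 3)" by (rule power_prod) simp
    finally show ?thesis .
  qed
  moreover have "0 \<le> Q ^ (t + p + 3)" by simp
  ultimately have "\<theta> + Q * qint (t + 1) * \<theta> \<le> 8 * Q ^ (t + p + 3)" by linarith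
  also have "8 * Q ^ (t + p + 3) = 2 ^ 3 * Q ^ (t + p + 3)" by simp
  also have "\<dots> \<le> Q ^ Suc l" using l_gap t_pos by (intro power_gap) simp
  finally have "(\<theta> + Q * qint (t + 1) * \<theta>) * b \<le> Q * (Q ^ l * b)"
    using b_ge_1 mult_right_mono[of _ "Q ^ Suc l" b] by simp
  also have "\<dots> < Q * a" using a_gt Q_ge_2 by (intro mult_strict_left_mono) auto
  finally have "\<mu> * ((\<theta> + Q * qint (t + 1) * \<theta>) * b) < \<mu> * (Q * a)"
    using theta_mu_bounds by (intro mult_strict_left_mono) auto
  moreover have "\<theta> * a = a + \<mu> * (Q * a)" using theta_mu_bounds(2) by (simp add: algebra_simps)
  moreover have "unique_size = a + qint (t + 1) * (Q * \<mu> * (\<theta> * b))"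
    unfolding unique_size_def theta_mu_bounds(2) ..
  ultimately show ?thesis using h1_ge_crude by (simp add: algebra_simps)
qed

text \<open>Again the surplus Q^(p+2) a decides: each of the three coefficients of
  \<open>\<theta> * b\<close> involved is at most Q^(p+2).\<close>

lemma pencil_size_less_h1: "pencil_size < h1"
proof -
  have T: "qint (t + 2) \<le> \<mu>" unfolding \<mu>_def using large by (intro qint_mono) simp
  have "(\<theta> - \<mu>) + (qint (t + 2) - qint 2) + \<mu> \<le> 3 * Q ^ (p + 2)"
    using theta_mu_bounds T qint_nonneg[of 2] by linarith
  then have "((\<theta> - \<mu>) + (qint (t + 2) - qint 2) + \<mu>) * \<theta> \<le> (3 * Q ^ (p + 2)) * (2 * Q ^ (p + 2))"
    using theta_mu_bounds by (intro mult_mono) auto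
  also have "\<dots> \<le> Q ^ (p + 2) * (2 ^ 3 * Q ^ (p + 2))" by simp
  also have "\<dots> \<le> Q ^ (p + 2) * Q ^ l"
    using l_gap t_pos Q_ge_2 by (intro mult_left_mono power_gap) auto
  finally have "((\<theta> - \<mu>) + (qint (t + 2) - qint 2) + \<mu>) * \<theta> * b \<le> Q ^ (p + 2) * (Q ^ l * b)"
    using b_ge_1 mult_right_mono[of _ "Q ^ (p + 2) * Q ^ l" b] by (simp add: mult.assoc)
  also have "\<dots> < Q ^ (p + 2) * a" using a_gt Q_ge_2 by (intro mult_strict_left_mono) auto
  finally have "(\<theta> - \<mu>) * (\<theta> * b) + (qint (t + 2) - qint 2) * (\<theta> * b) + \<mu> * \<theta> * b < Q ^ (p + 2) * a"
    by (simp add: algebra_simps)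
  moreover have "\<theta> * a = \<mu> * a + Q ^ (p + 2) * a" using theta_mu_bounds(1) by (simp only: distrib_right)
  ultimately show ?thesis using h1_ge_crude unfolding pencil_size_def by linarith
qed

text \<open>Division by \<open>\<theta>\<close> turns the worst case m = t + 2 into a comparison
  with (Q + 1) Q^l. It consumes the whole gap: l \<ge> p + 6 for t = 1 and l \<ge> p + 2t + 6 for t
  \<ge> 2.\<close>

lemma none_size_less_h1:
  assumes "t + 2 \<le> m" "m \<le> t + p + 2" shows "none_size m < h1"
proof -
  have th0: "0 < \<theta>" using theta_mu_bounds by linarith
  have "(Q + 1) * \<mu> + qint (t + 2) * qint (t + 1) * \<theta> \<le> (Q + 1) * Q ^ l"
  proof (cases "t = 1")
    case True
    have T: "qint (t + 1) = Q + 1" "qint (t + 2) = Q * Q + Q + 1"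
      using True qint_Suc[of 0] qint_Suc[of 1] qint_Suc[of 2] by (simp_all add: numeral_eq_Suc algebra_simps)
    \<comment> \<open>For Q = 2 the estimate \<open>qint_le\<close> would already fill Q^(p+6) and
      leave no room for \<open>\<mu>\<close>; multiplying by Q - 1 evaluates \<open>\<mu>\<close>
      and \<open>\<theta>\<close> exactly.\<close>
    have "(\<mu> + (Q * Q + Q + 1) * \<theta>) * (Q - 1) = (Q ^ (p + 2) - 1) + (Q * Q + Q + 1) * (Q * Q ^ (p + 2) - 1)"
    proof -
      have "\<mu> * (Q - 1) = Q ^ (p + 2) - 1" "\<theta> * (Q - 1) = Q * Q ^ (p + 2) - 1"
        using qint_mult[of "p + 2"] qint_mult[of "p + 3"] unfolding \<mu>_def \<theta>_def by (simp_all add: numeral_eq_Suc)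
      then show ?thesis by (simp only: distrib_right mult.assoc)
    qed
    also have "\<dots> \<le> (1 + Q + Q ^ 2 + Q ^ 3) * Q ^ (p + 2)"
      using Q_ge_2 by (simp add: algebra_simps power2_eq_square power3_eq_cube)
    also have "\<dots> \<le> Q ^ 4 * (Q - 1) * Q ^ (p + 2)"
    proof (rule mult_right_mono)
      have "1 + Q + Q ^ 2 + Q ^ 3 = qint 4" by (simp add: qint_sum numeral_eq_Suc)
      also have "\<dots> \<le> Q ^ 4" using qint_le_power[of 4] by simp
      also have "\<dots> \<le> Q ^ 4 * (Q - 1)" using Q_ge_2 by simp
      finally show "1 + Q + Q ^ 2 + Q ^ 3 \<le> Q ^ 4 * (Q - 1)" .
    qed simp
    also have "\<dots> = Q ^ (p + 6) * (Q - 1)" by (simp add: power_add mult_ac numeral_eq_Suc)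
    finally have "\<mu> + (Q * Q + Q + 1) * \<theta> \<le> Q ^ (p + 6)" using Q_ge_2 by (simp add: mult_le_cancel_right)
    also have "\<dots> \<le> Q ^ l" using l_gap(1) True Q_ge_2 by (intro power_increasing) auto
    finally have "(Q + 1) * (\<mu> + (Q * Q + Q + 1) * \<theta>) \<le> (Q + 1) * Q ^ l"
      using Q_ge_2 by (intro mult_left_mono) auto
    then show ?thesis unfolding T by (simp add: algebra_simps)
  next
    case False
    then have l6: "p + 2 * t + 6 \<le> l" using l_gap by simp
    have "qint (t + 2) * qint (t + 1) * \<theta> \<le> 2 * Q ^ (t + 1) * (2 * Q ^ t) * (2 * Q ^ (p + 2))"
      using theta_mu_bounds qint_t_bounds qint_nonneg by (intro mult_mono) auto
    also have "\<dots> = 2 ^ 3 * ((Q ^ (t + 1) * Q ^ t) * Q ^ (p + 2))" by simp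
    also have "Q ^ (t + 1) * Q ^ t = Q ^ (2 * t + 1)" by (rule power_prod) simp
    also have "Q ^ (2 * t + 1) * Q ^ (p + 2) = Q ^ (2 * t + p + 3)" by (rule power_prod) simp
    also have "2 ^ 3 * Q ^ (2 * t + p + 3) \<le> Q ^ l" using l6 by (intro power_gap) simp
    finally have 1: "qint (t + 2) * qint (t + 1) * \<theta> \<le> Q ^ l" .
    have "2 * Q ^ (p + 2) \<le> Q ^ l" using power_gap[of "p + 2" 1 l] l6 by simp
    then have "2 * \<mu> \<le> Q ^ l" using theta_mu_bounds by linarith
    then have "Q * (2 * \<mu>) \<le> Q * Q ^ l" using Q_ge_2 by (intro mult_left_mono) auto
    moreover have "2 * \<mu> \<le> Q * \<mu>" using Q_ge_2 theta_mu_bounds by (intro mult_right_mono) auto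
    moreover have "(Q + 1) * \<mu> = Q * \<mu> + \<mu>" "(Q + 1) * Q ^ l = Q * Q ^ l + Q ^ l"
      "Q * (2 * \<mu>) = Q * \<mu> + Q * \<mu>" by (simp_all add: algebra_simps)
    ultimately show ?thesis using 1 theta_mu_bounds(3) by linarith
  qed
  then have "((Q + 1) * \<mu> + qint (t + 2) * qint (t + 1) * \<theta>) * b \<le> (Q + 1) * Q ^ l * b"
    using b_ge_1 by (intro mult_right_mono) auto
  also have "\<dots> < (Q + 1) * a" unfolding mult.assoc using a_gt Q_ge_2 by (intro mult_strict_left_mono) auto
  finally have "\<theta> * (((Q + 1) * \<mu> + qint (t + 2) * qint (t + 1) * \<theta>) * b) < \<theta> * ((Q + 1) * a)"
    using th0 by (intro mult_strict_left_mono) auto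
  then have "(Q + 1) * none_size (t + 2) < (Q + 1) * (\<theta> * a - \<mu> * \<theta> * b)"
    unfolding none_size_base by (simp add: algebra_simps power2_eq_square)
  then have "none_size (t + 2) < \<theta> * a - \<mu> * \<theta> * b" using Q_ge_2 by (simp add: mult_less_cancel_left)
  then show ?thesis using none_size_le[OF assms] h1_ge_crude by linarith
qed

end

subsection \<open>The range \<open>k \<le> 2 t + 1\<close>\<close>

context
  assumes small: "p + 1 \<le> t"
begin

text \<open>By [t+2,1] = Q [t+1,1] + 1 and \<open>\<theta>\<close> - 1 = Q \<open>\<mu>\<close>,
  both sides are \<open>a\<close> plus a multiple of Q [t+1,1]. Cancelling leaves (1 +
  \<open>\<mu> * \<theta>\<close>) b < a.\<close>

lemma unique_size_less_h3: "unique_size < h3"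
proof -
  have "\<mu> * \<theta> \<le> (2 * Q ^ (p + 1)) * (2 * Q ^ (p + 2) - 1)"
    using theta_mu_bounds by (intro mult_mono) auto
  also have "\<dots> = 2 ^ 2 * (Q ^ (p + 1) * Q ^ (p + 2)) - 2 * Q ^ (p + 1)"
    by (simp add: right_diff_distrib)
  also have "Q ^ (p + 1) * Q ^ (p + 2) = Q ^ (2 * p + 3)" by (rule power_prod) simp
  finally have "1 + \<mu> * \<theta> \<le> 2 ^ 2 * Q ^ (2 * p + 3)" using one_le_power[of Q "p + 1"] Q_ge_2 by linarith
  also have "\<dots> \<le> Q ^ l" using l_gap(1) small by (intro power_gap) simp
  finally have "(1 + \<mu> * \<theta>) * b < a" by (rule mult_b_less_a)
  then have "Q * qint (t + 1) * ((1 + \<mu> * \<theta>) * b) < Q * qint (t + 1) * a"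
    using qint_t_bounds Q_ge_2 by (intro mult_strict_left_mono) auto
  moreover have "unique_size = a + qint (t + 1) * (Q * \<mu> * (\<theta> * b))"
    unfolding unique_size_def theta_mu_bounds(2) ..
  ultimately show ?thesis unfolding h3_def qint_t_bounds(1) by (simp add: algebra_simps)
qed

text \<open>Now \<open>\<mu>\<close> is at most [t+1,1], and [t+2,1] = [t+1,1] + Q^(t+1): the
  surplus Q^(t+1) a pays for all terms in \<open>b\<close>.\<close>

lemma pencil_size_less_h3: "pencil_size < h3"
proof -
  have T: "\<mu> \<le> qint (t + 1)" unfolding \<mu>_def using small by (intro qint_mono) simp
  have a0: "0 < a" using b_less_a b_ge_1 by linarith
  have pp: "Q ^ (p + 2) \<le> Q ^ (t + 1)" using small Q_ge_2 by (intro power_increasing) auto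
  have "Q * qint (t + 1) \<le> Q * (2 * Q ^ t)" using qint_t_bounds Q_ge_2 by (intro mult_left_mono) auto
  also have "\<dots> = Q ^ (t + 1) * 2 * 1" by simp
  also have "\<dots> \<le> Q ^ (t + 1) * 2 * Q ^ (p + 2)"
    using Q_ge_2 by (intro mult_left_mono one_le_power) auto
  finally have 1: "Q * qint (t + 1) \<le> 2 * (Q ^ (t + 1) * Q ^ (p + 2))" by simp
  have "(\<theta> - \<mu>) + (qint (t + 2) - qint 2) \<le> 3 * Q ^ (t + 1)"
    using theta_mu_bounds(1) qint_t_bounds(5) qint_nonneg[of 2] pp by linarith
  then have "((\<theta> - \<mu>) + (qint (t + 2) - qint 2)) * \<theta> \<le> 3 * Q ^ (t + 1) * (2 * Q ^ (p + 2))"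
    using theta_mu_bounds by (intro mult_mono) auto
  with 1 have "Q * qint (t + 1) + ((\<theta> - \<mu>) + (qint (t + 2) - qint 2)) * \<theta> \<le> Q ^ (t + 1) * (2 ^ 3 * Q ^ (p + 2))"
    by simp
  also have "\<dots> \<le> Q ^ (t + 1) * Q ^ l"
    using l_gap t_pos Q_ge_2 by (intro mult_left_mono power_gap) auto
  finally have "(Q * qint (t + 1) + ((\<theta> - \<mu>) + (qint (t + 2) - qint 2)) * \<theta>) * b \<le> Q ^ (t + 1) * (Q ^ l * b)"
    using b_ge_1 mult_right_mono[of _ "Q ^ (t + 1) * Q ^ l" b] by (simp add: mult.assoc)
  also have "\<dots> < Q ^ (t + 1) * a" using a_gt Q_ge_2 by (intro mult_strict_left_mono) auto
  finally have "Q * qint (t + 1) * b + ((\<theta> - \<mu>) * (\<theta> * b) + (qint (t + 2) - qint 2) * (\<theta> * b)) < Q ^ (t + 1) * a"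
    by (simp add: algebra_simps)
  moreover have "\<mu> * a \<le> qint (t + 1) * a" using T a0 by (intro mult_right_mono) auto
  moreover have "qint (t + 2) * a = qint (t + 1) * a + Q ^ (t + 1) * a" using qint_t_bounds(2) by (simp only: distrib_right)
  ultimately show ?thesis unfolding pencil_size_def h3_def by linarith
qed

text \<open>Here [t+2,1] can be divided out, because \<open>h3\<close> is at least [t+2,1] (a - b).
  For t \<ge> 2 the final exponent count t + 2p + 7 \<le> p + 2t + 6 is sharp at p + 1 = t.\<close>

lemma none_size_less_h3:
  assumes "t + 2 \<le> m" "m \<le> t + p + 2" shows "none_size m < h3"
proof -
  have "qint (t + 1) * \<theta>\<^sup>2 + (Q + 1) \<le> (Q + 1) * Q ^ l"
  proof (cases "t = 1")
    case True
    then have p0: "p = 0" using small by simp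
    have T: "qint (t + 1) = Q + 1" using True qint_Suc[of 0] qint_Suc[of 1] by (simp add: numeral_eq_Suc)
    have "p + 2 = 2" using p0 by simp
    then have "\<theta> \<le> 2 * Q\<^sup>2 - 1" using theta_mu_bounds(5) by (simp only:)
    then have "\<theta>\<^sup>2 \<le> (2 * Q\<^sup>2 - 1)\<^sup>2" using theta_mu_bounds(3,4) by (intro power_mono) auto
    also have "\<dots> = 2 ^ 2 * (Q ^ 2 * Q ^ 2) - 4 * Q\<^sup>2 + 1"
    proof -
      have "(2 * w - 1)\<^sup>2 = 2 ^ 2 * (w * w) - 4 * w + 1" for w :: real
        by (simp add: power2_eq_square algebra_simps)
      then show ?thesis .
    qed
    also have "Q ^ 2 * Q ^ 2 = Q ^ 4" by (rule power_prod) simp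
    finally have "\<theta>\<^sup>2 + 1 \<le> 2 ^ 2 * Q ^ 4"
      using one_le_power[of Q 2] Q_ge_2 by linarith
    also have "\<dots> \<le> Q ^ l" using l_gap(1) True by (intro power_gap) simp
    finally have "(Q + 1) * (\<theta>\<^sup>2 + 1) \<le> (Q + 1) * Q ^ l" using Q_ge_2 by (intro mult_left_mono) auto
    then show ?thesis unfolding T by (simp add: algebra_simps)
  next
    case False
    then have l6: "p + 2 * t + 6 \<le> l" using l_gap by simp
    have "qint (t + 1) * \<theta>\<^sup>2 \<le> 2 * Q ^ t * (2 * Q ^ (p + 2))\<^sup>2"
      using theta_mu_bounds qint_t_bounds by (intro mult_mono power_mono) auto
    also have "\<dots> = 2 ^ 3 * (Q ^ t * (Q ^ (p + 2) * Q ^ (p + 2)))"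
      by (simp add: power2_eq_square)
    also have "Q ^ (p + 2) * Q ^ (p + 2) = Q ^ (2 * p + 4)" by (rule power_prod) simp
    also have "Q ^ t * Q ^ (2 * p + 4) = Q ^ (t + 2 * p + 4)" by (rule power_prod) simp
    also have "2 ^ 3 * Q ^ (t + 2 * p + 4) \<le> Q ^ l" using l6 small by (intro power_gap) simp
    finally have 1: "qint (t + 1) * \<theta>\<^sup>2 \<le> Q ^ l" .
    have "2 * Q ^ 0 \<le> Q ^ l" using power_gap[of 0 1 l] l6 by simp
    then have "Q * 2 \<le> Q * Q ^ l" using Q_ge_2 by (intro mult_left_mono) auto
    moreover have "(Q + 1) * Q ^ l = Q * Q ^ l + Q ^ l" by (simp add: algebra_simps)
    ultimately show ?thesis using 1 Q_ge_2 by linarith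
  qed
  then have "(qint (t + 1) * \<theta>\<^sup>2 + (Q + 1)) * b \<le> (Q + 1) * Q ^ l * b"
    using b_ge_1 by (intro mult_right_mono) auto
  also have "\<dots> < (Q + 1) * a" unfolding mult.assoc using a_gt Q_ge_2 by (intro mult_strict_left_mono) auto
  finally have "qint (t + 2) * ((qint (t + 1) * \<theta>\<^sup>2 + (Q + 1)) * b) < qint (t + 2) * ((Q + 1) * a)"
    using qint_t_bounds Q_ge_2 by (intro mult_strict_left_mono) auto
  then have "(Q + 1) * none_size (t + 2) < (Q + 1) * (qint (t + 2) * a - qint (t + 2) * b)"
    unfolding none_size_base by (simp add: algebra_simps)
  then have "none_size (t + 2) < qint (t + 2) * a - qint (t + 2) * b" using Q_ge_2 by (simp add: mult_less_cancel_left)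
  moreover have "Q * qint (t + 1) * b \<le> qint (t + 2) * b" using qint_t_bounds(1) b_ge_1 by (intro mult_right_mono) auto
  ultimately show ?thesis using none_size_le[OF assms] unfolding h3_def by linarith
qed

text \<open>For p + 2 \<le> t the coefficients of \<open>a\<close> differ by at least Q^(t+1). At p
  + 1 = t the coefficients of \<open>a\<close> and \<open>b\<close> both agree; then Q^(p+3)
  \<open>qint t\<close> is added while its multiple by \<open>gb (p + l - 1) p\<close> is
  subtracted, and this factor exceeds 1 because p > 0.\<close>

lemma h1_less_h3: assumes "p + 1 < t \<or> 1 < t" shows "h1 < h3"
proof (cases "p + 1 = t")
  case False
  then have pt: "p + 3 \<le> t + 1" using small by simp
  have a0: "0 < a" using b_less_a b_ge_1 by linarith
  have "qint (p + 3) * a \<le> qint (t + 1) * a" using a0 pt by (intro mult_right_mono qint_mono) auto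
  moreover have "Q ^ (p + 3) * qint t \<le> Q ^ (t + 1) * qint t"
    using pt Q_ge_2 qint_nonneg by (intro mult_right_mono power_increasing) auto
  ultimately have 1: "h1 \<le> qint (t + 1) * a + Q ^ (t + 1) * qint t" using h1_le by linarith
  have "qint t + 2 \<le> Q ^ t + 1" using qint_le_power[of t] by simp
  also have "\<dots> \<le> 2 * Q ^ t" using one_le_power[of Q t] Q_ge_2 by simp
  also have "\<dots> \<le> Q ^ l" using power_gap[of t 1 l] l_gap by simp
  finally have "(qint t + 2) * b < a" by (rule mult_b_less_a)
  then have "Q ^ (t + 1) * ((qint t + 2) * b) < Q ^ (t + 1) * a" using Q_ge_2 by (intro mult_strict_left_mono) auto
  moreover have "Q ^ (t + 1) * qint t * 1 \<le> Q ^ (t + 1) * qint t * b"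
    using b_ge_1 qint_nonneg by (intro mult_left_mono) auto
  moreover have "Q * qint (t + 1) * b \<le> Q * (2 * Q ^ t) * b"
    using qint_t_bounds Q_ge_2 b_ge_1 by (intro mult_right_mono mult_left_mono) auto
  moreover have "qint (t + 2) * a = qint (t + 1) * a + Q ^ (t + 1) * a" using qint_t_bounds(2) by (simp only: distrib_right)
  ultimately show ?thesis using 1 unfolding h3_def by (simp add: algebra_simps)
next
  case True
  then obtain s where s: "p = Suc s" using assms by (cases p) auto
  have "1 < gb (p + l - 1) p" unfolding s using l_gap by (intro gb_gt_1) simp
  moreover have "0 < Q ^ (p + 3) * qint t"
    using qint_mono[of 1 t] qint_Suc[of 0] t_pos Q_ge_2 by simp
  ultimately have less: "Q ^ (p + 3) * qint t * 1 < Q ^ (p + 3) * qint t * gb (p + l - 1) p"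
    by (intro mult_strict_left_mono) auto
  have prod: "Q ^ 2 * qint (p + 1) * (Q ^ (p + 1) * gb (p + l - 1) p) = Q ^ (p + 3) * qint t * gb (p + l - 1) p"
  proof -
    have "Q ^ 2 * Q ^ (p + 1) = Q ^ (p + 3)" by (rule power_prod) simp
    moreover have "Q ^ 2 * qint (p + 1) * (Q ^ (p + 1) * gb (p + l - 1) p)
        = (Q ^ 2 * Q ^ (p + 1)) * qint (p + 1) * gb (p + l - 1) p" by (simp only: mult_ac)
    ultimately show ?thesis by (simp only: True)
  qed
  have "qint (p + 3) = qint (t + 2)" "qint (p + 2) = qint (t + 1)"
    by (rule arg_cong[where f = qint], use True in simp)+
  then have "h1 \<le> h3 - Q ^ (p + 3) * qint t * gb (p + l - 1) p + Q ^ (p + 3) * qint t"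
    using h1_le_sharp unfolding h3_def prod by (simp only:)
  then show ?thesis using less by linarith
qed

text \<open>For t = 1 and p = 0, that is k = 3, both \<open>b\<close> and the factor
  \<open>gb (p + l - 1) p\<close> are 1, and the upper and lower expansions of \<open>h1\<close>
  collapse to \<open>h3\<close>.\<close>

lemma h1_eq_h3: assumes "t = 1" shows "h1 = h3"
proof -
  have p0: "p = 0" using small assms by simp
  have b1: "b = 1" unfolding b_def by (simp add: p0)
  have c1: "gb (p + l - 1) p = 1" by (simp add: p0)
  have qint: "qint 1 = 1" "qint 2 = Q + 1" "qint 3 = Q * Q + Q + 1" "qint t = 1"
    using qint_Suc[of 0] qint_Suc[of 1] qint_Suc[of 2] assms by (simp_all add: numeral_eq_Suc algebra_simps)
  have e: "p + 3 = 3" "p + 2 = 2" "p + 1 = 1" "t + 2 = 3" "t + 1 = 2" using p0 assms by auto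
  have h3: "h3 = qint 3 * a - Q * qint 2" unfolding h3_def e b1 by simp
  have "h1 \<le> qint 3 * a - Q * qint 2 * 1 - Q ^ 2 * qint 1 * (Q ^ 1 * 1) + Q ^ 3 * qint t"
    using h1_le_sharp unfolding e b1 c1 .
  then have "h1 \<le> h3" unfolding h3 qint by (simp add: power2_eq_square power3_eq_cube)
  moreover have "qint 3 * a - (\<Sum>i<3. Q ^ i * qint i) * 1 + Q ^ 3 * qint t \<le> h1"
    using h1_ge unfolding e b1 .
  then have "h3 \<le> h1" unfolding h3 using qint
    by (simp add: numeral_3_eq_3 numeral_2_eq_2 algebra_simps)
  ultimately show ?thesis by simp
qed

end

end

section \<open>Subspaces of a finite vector space\<close>

text \<open>The ambient space need not be finite-dimensional. Subspaces of V are finite, so a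
  dimension can be read off from a cardinality, and the dimension formulas are obtained by
  counting.\<close>

locale fin_vector_space = vector_space scale
  for scale :: "'k::{field,finite} \<Rightarrow> 'v::ab_group_add \<Rightarrow> 'v" (infixr \<open>*s\<close> 75) +
  fixes V :: "'v set" and q :: nat
  assumes subspace_V: "subspace V" and finite_V: "finite V" and q_def: "q = CARD('k)"
begin

sublocale gauss q
proof
  have "card {0, 1 :: 'k} \<le> CARD('k)" by (intro card_mono) auto
  then show "2 \<le> q" by (simp add: q_def)
qed

abbreviation sbs :: "'v set \<Rightarrow> bool" where
  "sbs A \<equiv> subspace A \<and> A \<subseteq> V"

definition join :: "'v set \<Rightarrow> 'v set \<Rightarrow> 'v set" where
  "join A B = span (A \<union> B)"

lemma sbs_finite: "sbs A \<Longrightarrow> finite A"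
  using finite_V finite_subset by blast

lemma sbs_Int: "sbs A \<Longrightarrow> sbs B \<Longrightarrow> sbs (A \<inter> B)"
  by (auto intro: subspace_inter)

lemma sbs_join: "sbs A \<Longrightarrow> sbs B \<Longrightarrow> sbs (join A B)"
  unfolding join_def using span_minimal[OF _ subspace_V, of "A \<union> B"] by simp

lemma join_upper: "A \<subseteq> join A B" "B \<subseteq> join A B"
  unfolding join_def using span_superset[of "A \<union> B"] by auto

lemma join_least: "A \<subseteq> C \<Longrightarrow> B \<subseteq> C \<Longrightarrow> subspace C \<Longrightarrow> join A B \<subseteq> C"
  unfolding join_def by (intro span_minimal) auto

lemma join_eq: "subspace A \<Longrightarrow> subspace B \<Longrightarrow> join A B = {x + y | x y. x \<in> A \<and> y \<in> B}"
  unfolding join_def span_Un by (simp add: span_eq_iff[THEN iffD2])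

lemma card_span_independent:
  assumes "finite B" "independent B"
  shows "card (span B) = q ^ card B \<and> finite (span B)"
  using assms
proof (induction B rule: finite_induct)
  case empty
  then show ?case by simp
next
  case (insert a B)
  have a: "a \<notin> span B" and ind: "independent B"
    using insert.prems insert.hyps by (auto simp: independent_insert)
  have IH: "card (span B) = q ^ card B" "finite (span B)"
    using insert.IH ind by auto
  have eq: "span (insert a B) = (\<lambda>(x, k). x + k *s a) ` (span B \<times> UNIV)"
  proof (intro set_eqI iffI)
    fix x assume "x \<in> span (insert a B)"
    then obtain k where k: "x - k *s a \<in> span B" by (auto simp: span_breakdown_eq)
    then show "x \<in> (\<lambda>(x, k). x + k *s a) ` (span B \<times> UNIV)"
      by (intro image_eqI[of _ _ "(x - k *s a, k)"]) auto
  next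
    fix x assume "x \<in> (\<lambda>(x, k). x + k *s a) ` (span B \<times> UNIV)"
    then obtain y k where yk: "x = y + k *s a" "y \<in> span B" by auto
    then have "x - k *s a \<in> span B" by simp
    then show "x \<in> span (insert a B)" unfolding span_breakdown_eq by blast
  qed
  have inj: "inj_on (\<lambda>(x, k). x + k *s a) (span B \<times> UNIV)"
  proof (rule inj_onI, clarify)
    fix x k y l assume xy: "x \<in> span B" "y \<in> span B" and e: "x + k *s a = y + l *s a"
    have "(k - l) *s a = y - x" using e by (simp add: scale_left_diff_distrib algebra_simps)
    then have m: "(k - l) *s a \<in> span B" using xy span_diff by metis
    have "k = l"
    proof (rule ccontr)
      assume "k \<noteq> l"
      then have "a = inverse (k - l) *s ((k - l) *s a)" by simp
      then have "a \<in> span B" using span_scale[OF m] by metis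
      with a show False by simp
    qed
    with e show "x = y \<and> k = l" by simp
  qed
  show ?case unfolding eq using IH insert.hyps
    by (simp add: card_image[OF inj] card_cartesian_product q_def)
qed

lemma card_sbs: assumes "sbs A" shows "card A = q ^ dim A"
proof -
  obtain B where B: "B \<subseteq> A" "independent B" "A \<subseteq> span B" "card B = dim A"
    using basis_exists by blast
  have "span B = A" using B assms by (intro span_subspace) auto
  with card_span_independent[of B] B sbs_finite[OF assms] show ?thesis
    by (metis finite_subset)
qed

lemma dim_eqI: "sbs A \<Longrightarrow> card A = q ^ d \<Longrightarrow> dim A = d"
  using card_sbs[of A] q_ge_2 by (simp add: power_inject_exp)

lemma sbs_dim_mono: assumes "sbs B" "subspace A" "A \<subseteq> B" shows "dim A \<le> dim B"
proof -
  have "card A \<le> card B" using assms sbs_finite by (intro card_mono) auto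
  then have "q ^ dim A \<le> q ^ dim B" using assms card_sbs by (metis subset_trans)
  then show ?thesis using q_ge_2 by (simp add: power_increasing_iff)
qed

lemma sbs_eqI: assumes "sbs B" "subspace A" "A \<subseteq> B" "dim B \<le> dim A" shows "A = B"
proof -
  have "dim A = dim B" using sbs_dim_mono assms by (metis le_antisym)
  then have "card A = card B" using assms card_sbs by (metis subset_trans)
  then show ?thesis using assms sbs_finite card_subset_eq by blast
qed

text \<open>Addition maps A \<times> B onto A + B with all fibres of size |A \<inter> B|. Comparing
  cardinalities as powers of q gives the formula.\<close>

lemma dim_join: assumes "sbs A" "sbs B"
  shows "dim (join A B) + dim (A \<inter> B) = dim A + dim B"
proof -
  have fin: "finite A" "finite B" using assms sbs_finite by auto
  have "card (A \<times> B) = (\<Sum>z\<in>join A B. card {p \<in> A \<times> B. fst p + snd p = z})"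
  proof -
    have "a + b \<in> join A B" if "a \<in> A" "b \<in> B" for a b
      using join_upper(1)[of A B] join_upper(2)[of B A] that sbs_join[OF assms] by (intro subspace_add) auto
    then have "A \<times> B = (\<Union>z\<in>join A B. {p \<in> A \<times> B. fst p + snd p = z})"
      by auto
    moreover have "card (\<Union>z\<in>join A B. {p \<in> A \<times> B. fst p + snd p = z})
        = (\<Sum>z\<in>join A B. card {p \<in> A \<times> B. fst p + snd p = z})"
      using fin sbs_finite[OF sbs_join[OF assms]] by (intro card_UN_disjoint) auto
    ultimately show ?thesis by simp
  qed
  also have "\<dots> = (\<Sum>z\<in>join A B. card (A \<inter> B))"
  proof (rule sum.cong[OF refl])
    fix z assume "z \<in> join A B"
    then obtain x y where xy: "z = x + y" "x \<in> A" "y \<in> B" using assms by (auto simp: join_eq)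
    have "bij_betw (\<lambda>w. (x + w, y - w)) (A \<inter> B) {p \<in> A \<times> B. fst p + snd p = z}"
    proof (rule bij_betw_byWitness[where f' = "\<lambda>p. fst p - x"])
      show "(\<lambda>p. fst p - x) ` {p \<in> A \<times> B. fst p + snd p = z} \<subseteq> A \<inter> B"
      proof (clarify, rule IntI)
        fix u v assume uv: "u \<in> A" "v \<in> B" "z = fst (u, v) + snd (u, v)"
        show "fst (u, v) - x \<in> A" using uv xy assms subspace_diff by auto
        have "u - x = y - v" using uv xy by (simp add: algebra_simps)
        then show "fst (u, v) - x \<in> B" using uv xy assms subspace_diff by auto
      qed
      show "(\<lambda>w. (x + w, y - w)) ` (A \<inter> B) \<subseteq> {p \<in> A \<times> B. fst p + snd p = z}"
        using xy subspace_add[of A x] subspace_diff[of B y] assms by auto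
      show "\<forall>p\<in>{p \<in> A \<times> B. fst p + snd p = z}. (x + (fst p - x), y - (fst p - x)) = p"
      proof
        fix p assume "p \<in> {p \<in> A \<times> B. fst p + snd p = z}"
        then have "fst p + snd p = x + y" using xy by simp
        then have "y - (fst p - x) = snd p" by (simp add: algebra_simps)
        then show "(x + (fst p - x), y - (fst p - x)) = p" by (simp add: prod_eq_iff)
      qed
    qed simp
    then show "card {p \<in> A \<times> B. fst p + snd p = z} = card (A \<inter> B)"
      by (rule bij_betw_same_card[symmetric])
  qed
  finally have "card A * card B = card (join A B) * card (A \<inter> B)"
    by (simp add: card_cartesian_product)
  then have "q ^ (dim A + dim B) = q ^ (dim (join A B) + dim (A \<inter> B))"
    using card_sbs[OF assms(1)] card_sbs[OF assms(2)] card_sbs[OF sbs_join[OF assms]]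
      card_sbs[OF sbs_Int[OF assms]] by (simp add: power_add)
  then show ?thesis using q_ge_2 by (simp add: power_inject_exp)
qed

lemma dim_extend:
  assumes "sbs S" "x \<in> V" "x \<notin> S"
  shows "dim (join S (span {x})) = Suc (dim S)" "sbs (join S (span {x}))"
    "x \<in> join S (span {x})"
proof -
  have x0: "x \<noteq> 0" using assms subspace_0 by blast
  have sx: "sbs (span {x})" using assms span_minimal[OF _ subspace_V] by simp
  have "dim (span {x}) = 1" using x0 by (simp add: dim_eq_card_independent)
  moreover have "dim (S \<inter> span {x}) = 0"
  proof -
    have "S \<inter> span {x} \<noteq> span {x}" using assms span_base[of x "{x}"] by auto
    then have "\<not> dim (span {x}) \<le> dim (S \<inter> span {x})"
      using sbs_eqI[OF sx, of "S \<inter> span {x}"] assms sx subspace_inter by blast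
    with \<open>dim (span {x}) = 1\<close> show ?thesis by simp
  qed
  ultimately show "dim (join S (span {x})) = Suc (dim S)" using dim_join[OF assms(1) sx] by simp
  show "sbs (join S (span {x}))" using assms sx sbs_join by blast
  show "x \<in> join S (span {x})" using join_upper(2)[of "span {x}" S] span_base[of x "{x}"] by auto
qed

lemma exists_between:
  assumes "sbs B" "subspace A" "A \<subseteq> B" "dim A \<le> d" "d \<le> dim B"
  obtains C where "sbs C" "A \<subseteq> C" "C \<subseteq> B" "dim C = d"
proof -
  have "\<exists>C. sbs C \<and> A \<subseteq> C \<and> C \<subseteq> B \<and> dim C = dim A + j" if "dim A + j \<le> dim B" for j
    using that
  proof (induction j)
    case 0
    then show ?case using assms by (intro exI[of _ A]) auto
  next
    case (Suc j)
    then obtain C where C: "sbs C" "A \<subseteq> C" "C \<subseteq> B" "dim C = dim A + j" by auto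
    have "C \<noteq> B" using C Suc.prems by auto
    then obtain x where x: "x \<in> B" "x \<notin> C" using C by blast
    have xV: "x \<in> V" using x assms by auto
    have "join C (span {x}) \<subseteq> B" using C x assms by (intro join_least span_minimal) auto
    then show ?case
      using dim_extend[OF C(1) xV x(2)] C join_upper(1)[of C "span {x}"]
      by (intro exI[of _ "join C (span {x})"]) auto
  qed
  from this[of "d - dim A"] assms that show ?thesis by auto
qed

section \<open>Counting subspaces with a prescribed intersection\<close>

definition meeting :: "'v set \<Rightarrow> 'v set \<Rightarrow> 'v set \<Rightarrow> nat \<Rightarrow> 'v set set" where
  "meeting S M W k = {F. subspace F \<and> S \<subseteq> F \<and> F \<subseteq> W \<and> dim F = k \<and> F \<inter> M = S}"

lemma finite_meeting: "sbs W \<Longrightarrow> finite (meeting S M W k)"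
  unfolding meeting_def using sbs_finite
  by (intro finite_subset[OF _ finite_Pow_iff[THEN iffD2, of W]]) auto

text \<open>The sets F - S partition W - M: a vector x outside M lies in exactly one such F, namely
  the span of S and x.\<close>

lemma card_meeting_Suc:
  assumes "sbs S" "sbs M" "sbs W" "S \<subseteq> M" "M \<subseteq> W"
  shows "real (card (meeting S M W (Suc (dim S)))) = real q ^ (dim M - dim S) * gb (dim W - dim M) 1"
proof -
  let ?A = "meeting S M W (Suc (dim S))"
  have fin: "finite ?A" using finite_meeting assms by blast
  have sm: "dim S \<le> dim M" "dim M \<le> dim W" using assms sbs_dim_mono by auto
  have un: "W - M = (\<Union>F\<in>?A. F - S)"
  proof (intro set_eqI iffI)
    fix x assume x: "x \<in> W - M"
    let ?F = "join S (span {x})"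
    have xV: "x \<in> V" "x \<notin> S" using x assms by auto
    note F = dim_extend[OF assms(1) xV]
    have FW: "?F \<subseteq> W" using x assms by (intro join_least span_minimal) auto
    have "?F \<inter> M = S"
    proof (rule ccontr)
      assume ne: "?F \<inter> M \<noteq> S"
      have sI: "sbs (?F \<inter> M)" using F assms sbs_Int by blast
      have "S \<subseteq> ?F \<inter> M" using assms join_upper by auto
      then have "dim (?F \<inter> M) > dim S" using ne sbs_eqI[OF sI, of S] assms by fastforce
      then have "?F \<inter> M = ?F" using F sI by (intro sbs_eqI) auto
      then show False using F x by auto
    qed
    then have "?F \<in> ?A" using F FW join_upper unfolding meeting_def by auto
    then show "x \<in> (\<Union>F\<in>?A. F - S)" using F xV by auto
  next
    fix x assume "x \<in> (\<Union>F\<in>?A. F - S)"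
    then show "x \<in> W - M" unfolding meeting_def by auto
  qed
  have "card (W - M) = (\<Sum>F\<in>?A. card (F - S))"
    unfolding un
  proof (rule card_UN_disjoint[OF fin])
    show "\<forall>F\<in>?A. finite (F - S)" unfolding meeting_def using assms(3) sbs_finite
      by (auto intro: finite_subset)
    show "\<forall>i\<in>?A. \<forall>j\<in>?A. i \<noteq> j \<longrightarrow> (i - S) \<inter> (j - S) = {}"
    proof (intro ballI impI, rule ccontr)
      fix F G assume FG: "F \<in> ?A" "G \<in> ?A" "F \<noteq> G" "(F - S) \<inter> (G - S) \<noteq> {}"
      then obtain x where x: "x \<in> F" "x \<in> G" "x \<notin> S" by auto
      have sF: "sbs F" "sbs G" and d: "dim F = Suc (dim S)" "dim G = Suc (dim S)"
        and SF: "S \<subseteq> F" "S \<subseteq> G"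
        using FG assms(3) unfolding meeting_def by auto
      have xV: "x \<in> V" using x sF by auto
      note J = dim_extend[OF assms(1) xV x(3)]
      have "join S (span {x}) = F"
        using J d x sF SF by (intro sbs_eqI join_least span_minimal) auto
      moreover have "join S (span {x}) = G"
        using J d x sF SF by (intro sbs_eqI join_least span_minimal) auto
      ultimately show False using FG by simp
    qed
  qed
  also have "\<dots> = (\<Sum>F\<in>?A. q ^ Suc (dim S) - q ^ dim S)"
  proof (rule sum.cong[OF refl])
    fix F assume "F \<in> ?A"
    then have F: "sbs F" "S \<subseteq> F" "dim F = Suc (dim S)" using assms(3) unfolding meeting_def by auto
    then show "card (F - S) = q ^ Suc (dim S) - q ^ dim S"
      using card_sbs[OF F(1)] card_sbs[OF assms(1)] sbs_finite[OF assms(1)]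
      by (simp add: card_Diff_subset)
  qed
  finally have c: "card (W - M) = card ?A * (q ^ Suc (dim S) - q ^ dim S)" by simp
  have cW: "card (W - M) = q ^ dim W - q ^ dim M"
    using card_sbs[OF assms(3)] card_sbs[OF assms(2)] sbs_finite[OF assms(2)] assms
    by (simp add: card_Diff_subset)
  have q0: "real q > 1" using q_ge_2 by simp
  have "real (q ^ Suc (dim S) - q ^ dim S) = real q ^ dim S * (real q - 1)"
    using q_ge_2 by (simp add: of_nat_diff power_increasing algebra_simps)
  moreover have "real (q ^ dim W - q ^ dim M)
      = real q ^ dim S * (real q ^ (dim M - dim S) * (real q ^ (dim W - dim M) - 1))"
  proof -
    have "q ^ dim M \<le> q ^ dim W" using sm q_ge_2 by (intro power_increasing) auto
    then have "real (q ^ dim W - q ^ dim M) = real q ^ dim W - real q ^ dim M"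
      by (simp add: of_nat_diff)
    moreover have "real q ^ dim S * real q ^ (dim M - dim S) = real q ^ dim M"
      using sm by (simp flip: power_add)
    moreover have "real q ^ dim M * real q ^ (dim W - dim M) = real q ^ dim W"
      using sm by (simp flip: power_add)
    ultimately show ?thesis by (simp add: right_diff_distrib flip: mult.assoc)
  qed
  ultimately have "real (card ?A) * (real q ^ dim S * (real q - 1))
      = real q ^ dim S * (real q ^ (dim M - dim S) * (real q ^ (dim W - dim M) - 1))"
    using c cW by (metis of_nat_mult)
  then have "real (card ?A) * (real q - 1) = real q ^ (dim M - dim S) * (real q ^ (dim W - dim M) - 1)"
    using q0 by simp
  also have "\<dots> = real q ^ (dim M - dim S) * gb (dim W - dim M) 1 * (real q - 1)"
    using gb_1 by simp
  finally show ?thesis using q0 by simp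
qed

text \<open>Modulo S these are the r-spaces avoiding a fixed space of dimension dim M - dim S. The
  induction counts pairs P \<subseteq> F with dim P = dim S + 1; for fixed P, the spaces P and M + P
  replace S and M, and the difference of their dimensions is unchanged.\<close>

lemma card_meeting:
  assumes "sbs S" "sbs M" "sbs W" "S \<subseteq> M" "M \<subseteq> W"
  shows "real (card (meeting S M W (dim S + r))) = real q ^ ((dim M - dim S) * r) * gb (dim W - dim M) r"
  using assms
proof (induction r arbitrary: S M)
  case 0
  have "meeting S M W (dim S) = {S}"
  proof -
    have "F = S" if "F \<in> meeting S M W (dim S)" for F
      using that 0 sbs_eqI[of F S] unfolding meeting_def by auto
    then show ?thesis using 0 unfolding meeting_def by auto
  qed
  then show ?case by simp
next
  case (Suc r)
  let ?A = "meeting S M W (dim S + Suc r)" and ?B = "meeting S M W (Suc (dim S))"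
  let ?R = "{(P, F). P \<in> ?B \<and> F \<in> ?A \<and> P \<subseteq> F}"
  have fin: "finite ?A" "finite ?B" using finite_meeting Suc.prems by auto
  have sm: "dim S \<le> dim M" "dim M \<le> dim W" using Suc.prems sbs_dim_mono by auto
  have fibF: "real (card {P \<in> ?B. P \<subseteq> F}) = gb (Suc r) 1" if F: "F \<in> ?A" for F
  proof -
    have sF: "sbs F" "S \<subseteq> F" "dim F = dim S + Suc r" "F \<inter> M = S" "F \<subseteq> W"
      using F Suc.prems unfolding meeting_def by auto
    have "{P \<in> ?B. P \<subseteq> F} = meeting S S F (Suc (dim S))"
      using sF unfolding meeting_def by auto
    then show ?thesis using card_meeting_Suc[of S S F] Suc.prems sF by simp
  qed
  have fibP: "real (card {F \<in> ?A. P \<subseteq> F}) = real q ^ ((dim M - dim S) * r) * gb (dim W - dim M - 1) r"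
    if P: "P \<in> ?B" for P
  proof -
    have sP: "sbs P" "S \<subseteq> P" "dim P = Suc (dim S)" "P \<inter> M = S" "P \<subseteq> W"
      using P Suc.prems unfolding meeting_def by auto
    let ?M = "join M P"
    have sM: "sbs ?M" using Suc.prems sP sbs_join by blast
    have MW: "?M \<subseteq> W" using Suc.prems sP join_least by blast
    have dM: "dim ?M = Suc (dim M)" using dim_join[of M P] Suc.prems sP by (simp add: Int_commute)
    have "{F \<in> ?A. P \<subseteq> F} = meeting P ?M W (dim P + r)"
    proof (intro set_eqI iffI)
      fix F assume "F \<in> {F \<in> ?A. P \<subseteq> F}"
      then have F: "subspace F" "S \<subseteq> F" "F \<subseteq> W" "dim F = dim S + Suc r" "F \<inter> M = S" "P \<subseteq> F"
        unfolding meeting_def by auto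
      \<comment> \<open>The modular law: P lies in F, so F \<inter> (M + P) = (F \<inter> M) + P =
        P.\<close>
      have "F \<inter> ?M \<subseteq> P"
      proof
        fix x assume x: "x \<in> F \<inter> ?M"
        then obtain y z where yz: "x = y + z" "y \<in> M" "z \<in> P"
          using Suc.prems sP by (auto simp: join_eq)
        have "y = x - z" using yz by simp
        then have "y \<in> F" using x yz F subspace_diff by blast
        then have "y \<in> P" using yz F sP by auto
        then show "x \<in> P" using yz sP subspace_add by auto
      qed
      then show "F \<in> meeting P ?M W (dim P + r)"
        using F sP join_upper(2)[of P M] unfolding meeting_def by auto
    next
      fix F assume F: "F \<in> meeting P ?M W (dim P + r)"
      then have F: "subspace F" "P \<subseteq> F" "F \<subseteq> W" "dim F = dim P + r" "F \<inter> ?M = P"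
        unfolding meeting_def by auto
      have "F \<inter> M = S" using F sP join_upper(1)[of M P] by blast
      then show "F \<in> {F \<in> ?A. P \<subseteq> F}" using F sP unfolding meeting_def by auto
    qed
    then show ?thesis using Suc.IH[OF sP(1) sM Suc.prems(3) join_upper(2) MW] dM sP sm by simp
  qed
  have "(\<Sum>F\<in>?A. real (card {P \<in> ?B. P \<subseteq> F})) = (\<Sum>P\<in>?B. real (card {F \<in> ?A. P \<subseteq> F}))"
    using sum.swap_restrict[OF fin, of "\<lambda>_ _. 1::real" "\<lambda>F P. P \<subseteq> F"] by simp
  then have "real (card ?A) * gb (Suc r) 1
      = real (card ?B) * (real q ^ ((dim M - dim S) * r) * gb (dim W - dim M - 1) r)"
    using fibF fibP by simp
  also have "real (card ?B) = real q ^ (dim M - dim S) * gb (dim W - dim M) 1"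
    using card_meeting_Suc Suc.prems by blast
  also have "real q ^ (dim M - dim S) * gb (dim W - dim M) 1
        * (real q ^ ((dim M - dim S) * r) * gb (dim W - dim M - 1) r)
      = real q ^ ((dim M - dim S) * Suc r) * (gb (dim W - dim M) 1 * gb (dim W - dim M - 1) r)"
    by (simp add: power_add)
  also have "gb (dim W - dim M) 1 * gb (dim W - dim M - 1) r = gb (dim W - dim M) (Suc r) * gb (Suc r) 1"
  proof (cases "dim W - dim M")
    case 0
    then show ?thesis by (simp add: gb_eq_0 del: of_nat_Suc of_nat_0 add: gb_eq_0[of 0 1, simplified] gb_eq_0[of 0 "Suc r", simplified])
  next
    case (Suc m)
    have q0: "real q - 1 \<noteq> 0" using q_ge_2 by simp
    have "gb (Suc m) 1 * (real q - 1) * gb m r = gb (Suc m) (Suc r) * (gb (Suc r) 1 * (real q - 1))"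
      unfolding gb_1 using gb_Suc[of m r] by simp
    then have "(real q - 1) * (gb (Suc m) 1 * gb m r) = (real q - 1) * (gb (Suc m) (Suc r) * gb (Suc r) 1)"
      by (simp only: mult_ac)
    then show ?thesis using q0 Suc by (simp del: of_nat_Suc)
  qed
  finally have fin_eq: "real (card ?A) * gb (Suc r) 1
      = real q ^ ((dim M - dim S) * Suc r) * gb (dim W - dim M) (Suc r) * gb (Suc r) 1" by simp
  have "gb (Suc r) 1 \<noteq> 0" using gb_1[of "Suc r"] q_power_gt_1[of r] by fastforce
  then show ?case using fin_eq by simp
qed

definition between :: "'v set \<Rightarrow> 'v set \<Rightarrow> nat \<Rightarrow> 'v set set" where
  "between S W d = {F. subspace F \<and> S \<subseteq> F \<and> F \<subseteq> W \<and> dim F = d}"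

lemma between_eq_meeting: "between S W d = meeting S S W d"
  unfolding between_def meeting_def by auto

lemma finite_between: "sbs W \<Longrightarrow> finite (between S W d)"
  unfolding between_eq_meeting by (rule finite_meeting)

lemma card_between:
  assumes "sbs S" "sbs W" "S \<subseteq> W" "dim S \<le> d"
  shows "real (card (between S W d)) = gb (dim W - dim S) (d - dim S)"
  using card_meeting[of S S W "d - dim S"] assms unfolding between_eq_meeting by simp

lemma sbs_0: "sbs {0}"
  using subspace_0[OF subspace_V] by simp

lemma dim_0 [simp]: "dim {0} = 0"
  using dim_eqI[OF sbs_0, of 0] by simp

lemma card_subspaces: "sbs W \<Longrightarrow> real (card (between {0} W d)) = gb (dim W) d"
  using card_between[OF sbs_0, of W d] subspace_0 by simp

end

section \<open>Maximal non-trivial families\<close>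

text \<open>Maximality may be assumed because a non-trivial family stays non-trivial when enlarged.
  \<open>nontrivial\<close> also supplies a member, as t-subspaces exist.\<close>

locale intersecting_family = fin_vector_space scale V q
  for scale :: "'k::{field,finite} \<Rightarrow> 'v::ab_group_add \<Rightarrow> 'v" (infixr \<open>*s\<close> 75) and V q +
  fixes n k t :: nat and \<F> :: "'v set set"
  assumes dim_V: "dim V = n" and t_pos: "0 < t" and t_le: "t + 2 \<le> k" and n_ge: "2 * k + t + 2 \<le> n"
    and \<F>_sub: "F \<in> \<F> \<Longrightarrow> sbs F \<and> dim F = k"
    and inter: "F \<in> \<F> \<Longrightarrow> G \<in> \<F> \<Longrightarrow> t \<le> dim (F \<inter> G)"
    and maximal: "sbs G \<Longrightarrow> dim G = k \<Longrightarrow> (\<And>F. F \<in> \<F> \<Longrightarrow> t \<le> dim (G \<inter> F)) \<Longrightarrow> G \<in> \<F>"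
    and nontrivial: "sbs X \<Longrightarrow> dim X = t \<Longrightarrow> \<exists>F\<in>\<F>. \<not> X \<subseteq> F"
begin

lemma sbs_V: "sbs V" using subspace_V by simp

lemma finite_\<F>: "finite \<F>"
  by (rule finite_subset[of _ "Pow V"]) (use \<F>_sub finite_V in auto)

section \<open>Degrees, covers and the cost of not being a cover\<close>

definition deg :: "'v set \<Rightarrow> real" where
  "deg S = real (card {F \<in> \<F>. S \<subseteq> F})"

definition cover :: "'v set \<Rightarrow> bool" where
  "cover S \<longleftrightarrow> (\<forall>F\<in>\<F>. t \<le> dim (S \<inter> F))"

text \<open>\<open>A\<close>, \<open>B\<close> and \<open>\<theta>\<close> are the counterparts of
  \<open>a\<close>, \<open>b\<close> and \<open>\<theta>\<close> in the size comparison, expressed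
  through n, k and t.\<close>

definition A :: real where "A = gb (n - (t + 1)) (k - (t + 1))"
definition B :: real where "B = gb (n - (t + 2)) (k - (t + 2))"
definition \<theta> :: real where "\<theta> = gb (k - t + 1) 1"

lemma deg_le: assumes "sbs S" shows "deg S \<le> gb (n - dim S) (k - dim S)"
proof (cases "dim S \<le> k")
  case True
  have "{F \<in> \<F>. S \<subseteq> F} \<subseteq> between S V k" using \<F>_sub unfolding between_def by auto
  then have "deg S \<le> real (card (between S V k))"
    unfolding deg_def using finite_between[OF sbs_V] by (simp add: card_mono)
  then show ?thesis using card_between[OF assms sbs_V _ True] dim_V assms by simp
next
  case False
  \<comment> \<open>Above dimension k the degree is 0, so the truncated difference k - dim S in the
    bound is harmless.\<close>
  have e: "{F \<in> \<F>. S \<subseteq> F} = {}" using \<F>_sub sbs_dim_mono[of _ S] assms False by fastforce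
  show ?thesis unfolding deg_def e by (simp add: gb_nonneg)
qed

lemma card_le_sum_deg:
  assumes "finite D" "\<And>F. F \<in> \<F> \<Longrightarrow> P F \<Longrightarrow> \<exists>S\<in>D. S \<subseteq> F"
  shows "real (card {F \<in> \<F>. P F}) \<le> (\<Sum>S\<in>D. deg S)"
proof -
  have "{F \<in> \<F>. P F} \<subseteq> (\<Union>S\<in>D. {F \<in> \<F>. S \<subseteq> F})" using assms(2) by blast
  then have "card {F \<in> \<F>. P F} \<le> card (\<Union>S\<in>D. {F \<in> \<F>. S \<subseteq> F})"
    using assms(1) finite_\<F> by (intro card_mono) auto
  also have "\<dots> \<le> (\<Sum>S\<in>D. card {F \<in> \<F>. S \<subseteq> F})" by (rule card_UN_le[OF assms(1)])
  finally have "real (card {F \<in> \<F>. P F}) \<le> real (\<Sum>S\<in>D. card {F \<in> \<F>. S \<subseteq> F})"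
    by (simp only: of_nat_le_iff)
  then show ?thesis unfolding deg_def by simp
qed

text \<open>Replacing \<open>F'\<close> by a subspace of suitable codimension makes every member through \<open>S\<close> meet it
  in one dimension more than \<open>S\<close> does; this gains one dimension with the best possible factor.\<close>
lemma noncover_extension:
  assumes S: "sbs S" and F': "F' \<in> \<F>" "dim (S \<inter> F') < t"
  obtains E where "sbs E" "S \<subseteq> E" "dim E = dim S + (k - t + 1)"
    "\<And>F. F \<in> \<F> \<Longrightarrow> S \<subseteq> F \<Longrightarrow> dim S + 1 \<le> dim (F \<inter> E)"
proof -
  let ?i = "dim (S \<inter> F')"
  have sF': "sbs F'" "dim F' = k" using \<F>_sub F' by auto
  have sSF: "sbs (S \<inter> F')" using S sF' sbs_Int by blast
  \<comment> \<open>G has codimension t - \<open>?i\<close> - 1 in F'. A member through S meets F'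
    in dimension at least t, hence meets G in dimension at least \<open>?i\<close> + 1, which does
    not fit into S \<inter> F'.\<close>
  obtain G where G: "sbs G" "S \<inter> F' \<subseteq> G" "G \<subseteq> F'" "dim G = ?i + (k - t + 1)"
    by (rule exists_between[of F' "S \<inter> F'" "?i + (k - t + 1)"]) (use sF' sSF F' t_le in auto)
  let ?E = "join S G"
  have SG: "S \<inter> G = S \<inter> F'" using G by auto
  have sE: "sbs ?E" using S G sbs_join by blast
  have dE: "dim ?E = dim S + (k - t + 1)" using dim_join[OF S G(1)] SG G by simp
  show ?thesis
  proof (rule that[OF sE join_upper(1) dE])
    fix F assume F: "F \<in> \<F>" "S \<subseteq> F"
    have sF: "sbs F" using \<F>_sub F by auto
    have "\<not> F \<inter> G \<subseteq> S"
    proof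
      assume "F \<inter> G \<subseteq> S"
      then have "F \<inter> G \<subseteq> S \<inter> F'" using G by auto
      then have "dim (F \<inter> G) \<le> ?i" using sSF sF G subspace_inter by (intro sbs_dim_mono) auto
      moreover have "dim (join (F \<inter> F') G) + dim (F \<inter> F' \<inter> G) = dim (F \<inter> F') + dim G"
        using sF sF' G by (intro dim_join sbs_Int) auto
      moreover have "F \<inter> F' \<inter> G = F \<inter> G" using G by auto
      moreover have "dim (join (F \<inter> F') G) \<le> k"
        using sF' G sF sbs_join[of "F \<inter> F'" G] sbs_Int[of F F'] sbs_dim_mono[OF sF'(1), of "join (F \<inter> F') G"] 
          join_least[of "F \<inter> F'" F' G] by auto
      ultimately show False using inter[OF F(1) F'(1)] G(4) t_le by simp
    qed
    then have "S \<noteq> F \<inter> ?E" using join_upper(2)[of G S] by auto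
    moreover have "S \<subseteq> F \<inter> ?E" using F join_upper(1) by auto
    ultimately have "\<not> dim (F \<inter> ?E) \<le> dim S"
      using sbs_eqI[of "F \<inter> ?E" S] sF sE sbs_Int S by blast
    then show "dim S + 1 \<le> dim (F \<inter> ?E)" by simp
  qed
qed

lemma obtain_super:
  assumes "sbs S" "S \<subseteq> W" "sbs W" "dim S + 1 \<le> dim W"
  obtains S' where "S' \<in> between S W (dim S + 1)"
proof -
  obtain C where "sbs C" "S \<subseteq> C" "C \<subseteq> W" "dim C = dim S + 1"
    by (rule exists_between[of W S "dim S + 1"]) (use assms in auto)
  then show ?thesis using that unfolding between_def by blast
qed

lemma deg_le_sum_extension:
  assumes "sbs S" "S \<subseteq> E" "sbs E" "\<And>F. F \<in> \<F> \<Longrightarrow> S \<subseteq> F \<Longrightarrow> dim S + 1 \<le> dim (F \<inter> E)"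
  shows "deg S \<le> (\<Sum>S'\<in>between S E (dim S + 1). deg S')"
  unfolding deg_def[of S]
proof (rule card_le_sum_deg[OF finite_between[OF assms(3)]])
  fix F assume F: "F \<in> \<F>" "S \<subseteq> F"
  have "sbs (F \<inter> E)" using sbs_Int[OF _ assms(3)] \<F>_sub[OF F(1)] by simp
  then obtain S' where "S' \<in> between S (F \<inter> E) (dim S + 1)"
    using obtain_super[of S "F \<inter> E"] F assms by blast
  then show "\<exists>S'\<in>between S E (dim S + 1). S' \<subseteq> F" unfolding between_def by auto
qed

lemma deg_noncover:
  assumes S: "sbs S" "\<not> cover S" and le: "\<And>S'. sbs S' \<Longrightarrow> dim S' = dim S + 1 \<Longrightarrow> deg S' \<le> b"
  shows "deg S \<le> \<theta> * b"
proof -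
  obtain F' where "F' \<in> \<F>" "dim (S \<inter> F') < t" using S(2) unfolding cover_def by auto
  from noncover_extension[OF S(1) this] obtain E where E: "sbs E" "S \<subseteq> E"
    "dim E = dim S + (k - t + 1)" "\<And>F. F \<in> \<F> \<Longrightarrow> S \<subseteq> F \<Longrightarrow> dim S + 1 \<le> dim (F \<inter> E)" by blast
  have "deg S \<le> (\<Sum>S'\<in>between S E (dim S + 1). deg S')"
    using deg_le_sum_extension[OF S(1) E(2,1,4)] .
  also have "\<dots> \<le> (\<Sum>S'\<in>between S E (dim S + 1). b)"
    by (intro sum_mono le) (use E in \<open>auto simp: between_def\<close>)
  also have "\<dots> = \<theta> * b" using card_between[of S E "dim S + 1"] S E by (simp add: \<theta>_def)
  finally show ?thesis .
qed

lemma deg_noncover_t1: "sbs S \<Longrightarrow> dim S = t + 1 \<Longrightarrow> \<not> cover S \<Longrightarrow> deg S \<le> \<theta> * B"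
  using deg_le unfolding B_def by (intro deg_noncover) (auto, metis add_2_eq_Suc')

lemma deg_le_A: "sbs S \<Longrightarrow> dim S = t + 1 \<Longrightarrow> deg S \<le> A"
  using deg_le unfolding A_def by metis

text \<open>Below dimension m nothing is a cover, so \<open>deg_noncover\<close> applies at each of
  the j steps; in dimension m the trivial count takes over.\<close>

lemma deg_iterate:
  assumes "\<And>S. sbs S \<Longrightarrow> dim S < m \<Longrightarrow> \<not> cover S"
  shows "sbs S \<Longrightarrow> dim S + j = m \<Longrightarrow> deg S \<le> \<theta> ^ j * gb (n - m) (k - m)"
proof (induction j arbitrary: S)
  case 0
  then show ?case using deg_le[of S] by simp
next
  case (Suc j)
  then show ?case using deg_noncover[of S "\<theta> ^ j * gb (n - m) (k - m)"] assms[of S]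
    by (simp add: mult.assoc)
qed

text \<open>Such a space of dimension at most t would have dimension exactly t and lie in every
  member, making the family trivial.\<close>

lemma cover_dim_gt: assumes "sbs S" "cover S" shows "t < dim S"
proof (rule ccontr)
  assume "\<not> t < dim S"
  then have d: "dim S \<le> t" by simp
  have sub: "S \<subseteq> F \<and> dim S = t" if "F \<in> \<F>" for F
  proof -
    have "t \<le> dim (S \<inter> F)" using assms(2) that unfolding cover_def by auto
    moreover have "dim (S \<inter> F) \<le> dim S" using \<F>_sub[OF that] assms(1)
      by (intro sbs_dim_mono subspace_inter) auto
    moreover have "S \<inter> F = S" using \<F>_sub[OF that] assms(1) d calculation
      by (intro sbs_eqI subspace_inter) auto
    ultimately show ?thesis using d by auto
  qed
  \<comment> \<open>This t-space only serves to show that the family is nonempty.\<close>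
  obtain X where "sbs X" "dim X = t"
    using exists_between[OF sbs_V, of "{0}" t] sbs_0 dim_V n_ge by auto
  from nontrivial[OF this] obtain F where "F \<in> \<F>" by auto
  with sub have "dim S = t" by blast
  with nontrivial[OF assms(1)] sub show False by blast
qed

lemma member_cover: "F \<in> \<F> \<Longrightarrow> cover F"
  unfolding cover_def using inter by auto

text \<open>Every member contains one of the [m,t] t-subspaces of a cover of least dimension m.
  Starting the extension there instead of at the zero space leaves only m - t factors
  \<open>\<theta>\<close>.\<close>

lemma card_le_min_cover:
  assumes no: "\<And>S. sbs S \<Longrightarrow> cover S \<Longrightarrow> dim S \<noteq> t + 1"
  obtains m where "t + 2 \<le> m" "m \<le> k" "real (card \<F>) \<le> gb m t * \<theta> ^ (m - t) * gb (n - m) (k - m)"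
proof -
  obtain X where X: "sbs X" "dim X = t"
    using exists_between[OF sbs_V, of "{0}" t] sbs_0 dim_V n_ge by auto
  from nontrivial[OF this] obtain F where F: "F \<in> \<F>" by auto
  let ?P = "\<lambda>d. \<exists>S. sbs S \<and> cover S \<and> dim S = d"
  define m where "m = (LEAST d. ?P d)"
  have Pk: "?P k" using F \<F>_sub member_cover by blast
  have "?P m" unfolding m_def using Pk by (rule LeastI)
  then obtain T where T: "sbs T" "cover T" "dim T = m" by auto
  have mk: "m \<le> k" unfolding m_def using Pk by (rule Least_le)
  have "t < m" using cover_dim_gt T by auto
  with no[OF T(1,2)] T have tm: "t + 2 \<le> m" by auto
  have nc: "\<not> cover S" if "sbs S" "dim S < m" for S
    using not_less_Least[of "dim S" ?P] that unfolding m_def by blast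
  have "real (card {F \<in> \<F>. True}) \<le> (\<Sum>X\<in>between {0} T t. deg X)"
  proof (rule card_le_sum_deg[OF finite_between[OF T(1)]])
    fix F assume F: "F \<in> \<F>"
    then have "t \<le> dim (T \<inter> F)" using T unfolding cover_def by auto
    moreover have "sbs (T \<inter> F)" using T \<F>_sub[OF F] sbs_Int by blast
    ultimately obtain X where "sbs X" "X \<subseteq> T \<inter> F" "dim X = t"
      using exists_between[of "T \<inter> F" "{0}" t] sbs_0 subspace_0 by auto
    then show "\<exists>S\<in>between {0} T t. S \<subseteq> F" unfolding between_def using subspace_0 by auto
  qed
  also have "\<dots> \<le> (\<Sum>X\<in>between {0} T t. \<theta> ^ (m - t) * gb (n - m) (k - m))"
  proof (rule sum_mono)
    fix X assume "X \<in> between {0} T t"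
    then have "sbs X" "dim X = t" using T unfolding between_def by auto
    then show "deg X \<le> \<theta> ^ (m - t) * gb (n - m) (k - m)"
      using deg_iterate[OF nc] tm by simp
  qed
  also have "\<dots> = gb m t * \<theta> ^ (m - t) * gb (n - m) (k - m)"
    using card_subspaces[OF T(1), of t] T by simp
  finally show ?thesis using that[OF tm mk] by simp
qed

section \<open>Covers of dimension t+1 and the resulting cases\<close>

lemma super_cover_member:
  assumes "sbs T" "cover T" "T \<subseteq> G" "sbs G" "dim G = k" shows "G \<in> \<F>"
proof (rule maximal[OF assms(4,5)])
  fix F assume F: "F \<in> \<F>"
  have "dim (T \<inter> F) \<le> dim (G \<inter> F)"
    using assms \<F>_sub[OF F] sbs_Int[of G F] subspace_inter by (intro sbs_dim_mono) auto
  then show "t \<le> dim (G \<inter> F)" using assms F unfolding cover_def by force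
qed

text \<open>A k-space through T meeting T + U only in T belongs to the family by maximality. The
  cover U meets it in dimension at least t, and this intersection lies in T.\<close>

lemma covers_meet:
  assumes "sbs T" "cover T" "dim T = t + 1" "sbs U" "cover U" "dim U = t + 1"
  shows "t \<le> dim (T \<inter> U)"
proof -
  let ?J = "join T U"
  have sJ: "sbs ?J" using assms sbs_join by blast
  have dJ: "dim ?J \<le> 2 * t + 2" using dim_join[of T U] assms by simp
  \<comment> \<open>Such a k-space exists by counting, as n - 2t - 2 \<ge> k - t - 1.\<close>
  have "0 < gb (n - dim ?J) (k - (t + 1))" using dJ n_ge t_le by (intro gb_pos) auto
  then have "0 < real (card (meeting T ?J V (dim T + (k - (t + 1)))))"
    using card_meeting[of T ?J V "k - (t + 1)"] assms sJ sbs_V join_upper(1) dim_V q_ge_2 by simp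
  then have "meeting T ?J V k \<noteq> {}" using assms t_le by force
  then obtain G where G: "subspace G" "T \<subseteq> G" "G \<subseteq> V" "dim G = k" "G \<inter> ?J = T"
    unfolding meeting_def by auto
  then have "G \<in> \<F>" using super_cover_member assms by blast
  then have "t \<le> dim (U \<inter> G)" using assms unfolding cover_def by blast
  also have "U \<inter> G \<subseteq> T \<inter> U" using G join_upper(2)[of U T] by blast
  then have "dim (U \<inter> G) \<le> dim (T \<inter> U)" using assms G sbs_Int[of T U] subspace_inter
    by (intro sbs_dim_mono) auto
  finally show ?thesis .
qed

text \<open>X and T \<inter> F are different t-spaces in the (t+1)-space T and so span it. Thus one
  (k+1)-space, F + X, contains all (t+1)-dimensional covers through X.\<close>

lemma hyperplane_of_cover:
  assumes X: "sbs X" "dim X = t" and T: "sbs T" "cover T" "dim T = t + 1" "X \<subseteq> T"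
    and F: "F \<in> \<F>" "\<not> X \<subseteq> F"
  shows "dim (F \<inter> X) = t - 1" "T \<subseteq> join F X" "dim (join F X) = k + 1"
proof -
  have sF: "sbs F" "dim F = k" using \<F>_sub F by auto
  have sTF: "sbs (T \<inter> F)" "sbs (T \<inter> F \<inter> X)" "sbs (F \<inter> X)" using T sF X by (auto intro: subspace_inter)
  let ?J = "join (T \<inter> F) X"
  have J: "?J \<subseteq> T" "sbs ?J" using T sTF X join_least[of "T \<inter> F" T X] sbs_join by auto
  have dJ: "dim ?J \<le> t + 1" using sbs_dim_mono[OF T(1)] J T by metis
  have e: "dim ?J + dim (T \<inter> F \<inter> X) = dim (T \<inter> F) + t" using dim_join[of "T \<inter> F" X] sTF X by simp
  have tTF: "t \<le> dim (T \<inter> F)" using T F unfolding cover_def by auto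
  have "dim (T \<inter> F \<inter> X) \<le> dim (F \<inter> X)" using sTF by (intro sbs_dim_mono) auto
  moreover have "dim (F \<inter> X) < t"
    using sbs_eqI[OF X(1), of "F \<inter> X"] sTF X F by (metis Int_lower2 inf.absorb_iff2 linorder_not_le)
  ultimately show d: "dim (F \<inter> X) = t - 1" using e dJ tTF by simp
  have "dim ?J \<ge> t + 1" using e tTF \<open>dim (T \<inter> F \<inter> X) \<le> dim (F \<inter> X)\<close> d t_pos by simp
  then have "?J = T" using sbs_eqI[OF T(1)] J T by auto
  moreover have "?J \<subseteq> join F X"
    by (rule join_least) (use join_upper(1)[of F X] join_upper(2)[of X F] sbs_join sF X in auto)
  ultimately show "T \<subseteq> join F X" by simp
  show "dim (join F X) = k + 1" using dim_join[OF sF(1) X(1)] d X sF t_pos by simp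
qed

text \<open>F \<inter> G and X both lie in F \<inter> (G + X), and their span has dimension at least
  t + t - (t - 1).\<close>

lemma member_meets_join:
  assumes X: "sbs X" "dim X = t" and F: "F \<in> \<F>" "X \<subseteq> F" and G: "G \<in> \<F>" "dim (G \<inter> X) = t - 1"
  shows "t + 1 \<le> dim (F \<inter> join G X)"
proof -
  have s: "sbs F" "sbs G" using \<F>_sub F G by auto
  then have sFG: "sbs (F \<inter> G)" "sbs (F \<inter> G \<inter> X)" "sbs (G \<inter> X)" using X by (auto intro: subspace_inter)
  let ?J = "join (F \<inter> G) X"
  have "?J \<subseteq> F" using s F by (intro join_least) auto
  moreover have "?J \<subseteq> join G X"
    by (rule join_least) (use join_upper(1)[of G X] join_upper(2)[of X G] sbs_join s X in auto)
  ultimately have "dim ?J \<le> dim (F \<inter> join G X)"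
    using sbs_join[OF sFG(1) X(1)] sbs_join[OF s(2) X(1)] s sbs_Int by (intro sbs_dim_mono) blast+
  moreover have "dim ?J + dim (F \<inter> G \<inter> X) = dim (F \<inter> G) + t"
    using dim_join[OF sFG(1) X(1)] X by simp
  moreover have "dim (F \<inter> G \<inter> X) \<le> dim (G \<inter> X)" using sFG by (intro sbs_dim_mono) auto
  ultimately show ?thesis using inter[OF F(1) G(1)] G t_pos by simp
qed

text \<open>W meets T and U in two different t-spaces and hence lies in T + U. A member meeting T +
  U only in a t-space would meet all three covers in that t-space, which would be T \<inter> U and
  lie in W.\<close>

lemma three_covers:
  assumes T: "sbs T" "cover T" "dim T = t + 1" and U: "sbs U" "cover U" "dim U = t + 1"
    and "T \<noteq> U" and W: "sbs W" "cover W" "dim W = t + 1" "\<not> T \<inter> U \<subseteq> W"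
  shows "dim (T \<inter> U) = t" "dim (join T U) = t + 2"
    "\<And>F. F \<in> \<F> \<Longrightarrow> t + 1 \<le> dim (F \<inter> join T U)"
proof -
  have *: "dim (P \<inter> Q) = t" if "sbs P" "cover P" "dim P = t + 1" "sbs Q" "cover Q" "dim Q = t + 1"
    "P \<noteq> Q" for P Q
  proof -
    have "\<not> dim P \<le> dim (P \<inter> Q)"
      using sbs_eqI[of P "P \<inter> Q"] sbs_eqI[of Q P] that subspace_inter by fastforce
    then show ?thesis using covers_meet[OF that(1-6)] that by simp
  qed
  show TU: "dim (T \<inter> U) = t" using * T U \<open>T \<noteq> U\<close> by blast
  show "dim (join T U) = t + 2" using dim_join[of T U] T U TU by simp
  have sJ: "sbs (join T U)" using T U sbs_join by blast
  have sI: "sbs (T \<inter> U)" "sbs (W \<inter> T)" "sbs (W \<inter> U)" using T U W by (auto intro: subspace_inter)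
  have WT: "dim (W \<inter> T) = t" "dim (W \<inter> U) = t" using * T U W by blast+
  have "W \<subseteq> join T U"
  proof -
    let ?J = "join (W \<inter> T) (W \<inter> U)"
    have J: "?J \<subseteq> W" "sbs ?J" using W sI join_least[of "W \<inter> T" W "W \<inter> U"] sbs_join by auto
    have "dim ?J > t"
    proof (rule ccontr)
      assume "\<not> t < dim ?J"
      then have "W \<inter> T = ?J" "W \<inter> U = ?J"
        using sbs_eqI[OF J(2)] sI WT join_upper(1)[of "W \<inter> T"] join_upper(2)[of "W \<inter> U"] by auto
      then have "W \<inter> T \<subseteq> T \<inter> U" by auto
      then have "W \<inter> T = T \<inter> U" using sbs_eqI[of "T \<inter> U" "W \<inter> T"] sI WT TU by auto
      then show False using W(4) by auto
    qed
    then have "?J = W" using sbs_eqI[OF W(1), of ?J] J W by auto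
    moreover have "?J \<subseteq> join T U"
      by (rule join_least) (use sJ join_upper(1)[of T U] join_upper(2)[of U T] in auto)
    ultimately show ?thesis by simp
  qed
  fix F assume F: "F \<in> \<F>"
  then have sF: "sbs F" using \<F>_sub by auto
  then have sFJ: "sbs (F \<inter> join T U)" using sJ sbs_Int by blast
  show "t + 1 \<le> dim (F \<inter> join T U)"
  proof (rule ccontr)
    assume c: "\<not> t + 1 \<le> dim (F \<inter> join T U)"
    have e: "P \<inter> F = F \<inter> join T U \<and> t = dim (P \<inter> F)" if "P \<subseteq> join T U" "sbs P" "cover P" for P
    proof -
      have "t \<le> dim (P \<inter> F)" using that F unfolding cover_def by auto
      moreover have "P \<inter> F = F \<inter> join T U"
        using calculation c that sF subspace_inter by (intro sbs_eqI[OF sFJ]) auto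
      ultimately show ?thesis using c by simp
    qed
    have TF: "T \<inter> F = F \<inter> join T U" "dim (T \<inter> F) = t" using e[OF join_upper(1)] T by auto
    have UF: "U \<inter> F = F \<inter> join T U" using e[OF join_upper(2)] U by auto
    have WF: "W \<inter> F = F \<inter> join T U" using e[OF \<open>W \<subseteq> join T U\<close>] W by auto
    have "T \<inter> F = T \<inter> U"
    proof (rule sbs_eqI[OF sI(1)])
      show "subspace (T \<inter> F)" using T sF subspace_inter by auto
      show "T \<inter> F \<subseteq> T \<inter> U" using TF UF by blast
    qed (simp add: TF(2) TU)
    then show False using W(4) TF WF by blast
  qed
qed

text \<open>A member meets T at least in one of its [t+1,1] t-subspaces X. If it does not contain T,
  it contains a (t+1)-space between X and G + X, where G is a member not containing X. T is one of
  these \<open>\<theta>\<close> spaces; the other \<open>\<theta>\<close> - 1 are non-covers of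
  degree at most \<open>\<theta> * B\<close>.\<close>

lemma card_le_unique_cover:
  assumes T: "sbs T" "cover T" "dim T = t + 1"
    and uniq: "\<And>S. sbs S \<Longrightarrow> cover S \<Longrightarrow> dim S = t + 1 \<Longrightarrow> S = T"
  shows "real (card \<F>) \<le> A + gb (t + 1) 1 * ((\<theta> - 1) * (\<theta> * B))"
proof -
  have part: "real (card {F \<in> \<F>. X \<subseteq> F \<and> \<not> T \<subseteq> F}) \<le> (\<theta> - 1) * (\<theta> * B)"
    if "X \<in> between {0} T t" for X
  proof -
    have X: "sbs X" "dim X = t" "X \<subseteq> T" using that T unfolding between_def by auto
    obtain G where G: "G \<in> \<F>" "\<not> X \<subseteq> G" using nontrivial X by blast
    note h = hyperplane_of_cover[OF X(1,2) T X(3) G]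
    let ?E = "join G X"
    have sE: "sbs ?E" using X \<F>_sub[OF G(1)] sbs_join by blast
    have XE: "X \<subseteq> ?E" by (rule join_upper)
    let ?D = "between X ?E (t + 1)"
    have fD: "finite ?D" using finite_between[OF sE] .
    have TD: "T \<in> ?D" using T X h unfolding between_def by auto
    have "real (card {F \<in> \<F>. X \<subseteq> F \<and> \<not> T \<subseteq> F}) \<le> (\<Sum>S\<in>?D - {T}. deg S)"
    proof (rule card_le_sum_deg)
      fix F assume F: "F \<in> \<F>" "X \<subseteq> F \<and> \<not> T \<subseteq> F"
      have "sbs (F \<inter> ?E)" using sE \<F>_sub[OF F(1)] sbs_Int by blast
      then obtain S where "S \<in> between X (F \<inter> ?E) (dim X + 1)"
        using obtain_super[of X "F \<inter> ?E"] member_meets_join[OF X(1,2) F(1) _ G(1) h(1)] F X XE by auto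
      then show "\<exists>S\<in>?D - {T}. S \<subseteq> F" using F X unfolding between_def by auto
    qed (use fD in simp)
    also have "\<dots> \<le> (\<Sum>S\<in>?D - {T}. \<theta> * B)"
    proof (rule sum_mono)
      fix S assume S: "S \<in> ?D - {T}"
      then have "sbs S" "dim S = t + 1" "S \<noteq> T" using sE unfolding between_def by auto
      then show "deg S \<le> \<theta> * B" using deg_noncover_t1 uniq by blast
    qed
    also have "\<dots> = (\<theta> - 1) * (\<theta> * B)"
    proof -
      have "card ?D \<ge> 1" using TD fD by (metis One_nat_def Suc_leI card_gt_0_iff empty_iff)
      moreover have "real (card ?D) = \<theta>"
        using card_between[OF X(1) sE XE, of "t + 1"] X h t_le by (simp add: \<theta>_def Suc_diff_le)
      ultimately show ?thesis using TD fD by (simp add: of_nat_diff)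
    qed
    finally show ?thesis .
  qed
  have "\<F> \<subseteq> {F \<in> \<F>. T \<subseteq> F} \<union> (\<Union>X\<in>between {0} T t. {F \<in> \<F>. X \<subseteq> F \<and> \<not> T \<subseteq> F})"
  proof
    fix F assume F: "F \<in> \<F>"
    have "sbs (T \<inter> F)" "t \<le> dim (T \<inter> F)" using T \<F>_sub[OF F] sbs_Int F unfolding cover_def by blast+
    then obtain X where "sbs X" "X \<subseteq> T \<inter> F" "dim X = t"
      using exists_between[of "T \<inter> F" "{0}" t] sbs_0 subspace_0 by auto
    then show "F \<in> {F \<in> \<F>. T \<subseteq> F} \<union> (\<Union>X\<in>between {0} T t. {F \<in> \<F>. X \<subseteq> F \<and> \<not> T \<subseteq> F})"
      unfolding between_def using subspace_0 F by auto
  qed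
  then have "card \<F> \<le> card ({F \<in> \<F>. T \<subseteq> F} \<union> (\<Union>X\<in>between {0} T t. {F \<in> \<F>. X \<subseteq> F \<and> \<not> T \<subseteq> F}))"
    using finite_\<F> finite_between[OF T(1)] by (intro card_mono) auto
  also have "\<dots> \<le> card {F \<in> \<F>. T \<subseteq> F} + card (\<Union>X\<in>between {0} T t. {F \<in> \<F>. X \<subseteq> F \<and> \<not> T \<subseteq> F})"
    by (rule card_Un_le)
  also have "card (\<Union>X\<in>between {0} T t. {F \<in> \<F>. X \<subseteq> F \<and> \<not> T \<subseteq> F})
      \<le> (\<Sum>X\<in>between {0} T t. card {F \<in> \<F>. X \<subseteq> F \<and> \<not> T \<subseteq> F})"
    by (rule card_UN_le) (rule finite_between[OF T(1)])
  finally have "card \<F> \<le> card {F \<in> \<F>. T \<subseteq> F}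
      + (\<Sum>X\<in>between {0} T t. card {F \<in> \<F>. X \<subseteq> F \<and> \<not> T \<subseteq> F})" by simp
  then have "real (card \<F>) \<le> real (card {F \<in> \<F>. T \<subseteq> F}
      + (\<Sum>X\<in>between {0} T t. card {F \<in> \<F>. X \<subseteq> F \<and> \<not> T \<subseteq> F}))"
    by (simp only: of_nat_le_iff)
  then have "real (card \<F>) \<le> deg T + (\<Sum>X\<in>between {0} T t. real (card {F \<in> \<F>. X \<subseteq> F \<and> \<not> T \<subseteq> F}))"
    unfolding deg_def by simp
  also have "\<dots> \<le> A + (\<Sum>X\<in>between {0} T t. (\<theta> - 1) * (\<theta> * B))"
    by (intro add_mono deg_le_A sum_mono part T)
  also have "(\<Sum>X\<in>between {0} T t. (\<theta> - 1) * (\<theta> * B)) = gb (t + 1) 1 * ((\<theta> - 1) * (\<theta> * B))"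
    using card_subspaces[OF T(1), of t] T gb_hyperplanes[of t] by simp
  finally show ?thesis by simp
qed

text \<open>All (t+1)-dimensional covers lie in both G + X and H + X, whose intersection has
  dimension at most k. So at most [k-t,1] of the \<open>\<theta>\<close> spaces between X and G + X
  are covers. A member not containing X meets T + U in a (t+1)-space not containing X; there are
  [t+2,1] - [2,1] of these, and none is a cover.\<close>

lemma card_le_pencil_of_covers:
  assumes X: "sbs X" "dim X = t"
    and T: "sbs T" "cover T" "dim T = t + 1" "X \<subseteq> T"
    and U: "sbs U" "cover U" "dim U = t + 1" "X \<subseteq> U" "T \<noteq> U"
    and all: "\<And>S. sbs S \<Longrightarrow> cover S \<Longrightarrow> dim S = t + 1 \<Longrightarrow> X \<subseteq> S"
    and G: "G \<in> \<F>" "\<not> X \<subseteq> G" and H: "H \<in> \<F>" "\<not> X \<subseteq> H" "\<not> H \<subseteq> join G X"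
  shows "real (card \<F>) \<le> gb (k - t) 1 * A + (\<theta> - gb (k - t) 1) * (\<theta> * B)
    + (gb (t + 2) 1 - gb 2 1) * (\<theta> * B)"
proof -
  note hG = hyperplane_of_cover[OF X T G] and hH = hyperplane_of_cover[OF X T H(1,2)]
  have sG: "sbs G" "sbs H" using \<F>_sub G H by auto
  let ?E = "join G X" and ?E' = "join H X"
  have sE: "sbs ?E" "sbs ?E'" using sG X by (simp_all only: sbs_join)
  then have sEE: "sbs (?E \<inter> ?E')" by (auto intro: subspace_inter)
  have XE: "X \<subseteq> ?E" "X \<subseteq> ?E'" by (rule join_upper)+
  have nk: "\<not> k + 1 \<le> dim (?E \<inter> ?E')"
  proof
    assume "k + 1 \<le> dim (?E \<inter> ?E')"
    then have "?E \<inter> ?E' = ?E'" using sbs_eqI[OF sE(2), of "?E \<inter> ?E'"] sEE hH by auto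
    then show False using H(3) join_upper(1)[of H X] by auto
  qed
  \<comment> \<open>D pads the intersection to dimension exactly k, so that the possible covers
    through X can be counted without knowing its dimension.\<close>
  obtain D where D: "sbs D" "?E \<inter> ?E' \<subseteq> D" "D \<subseteq> ?E" "dim D = k"
    by (rule exists_between[OF sE(1), of "?E \<inter> ?E'" k]) (use sEE hG nk in auto)
  let ?P = "between X ?E (t + 1)" and ?Q = "between X D (t + 1)"
  have QP: "?Q \<subseteq> ?P" using D unfolding between_def by auto
  have fP: "finite ?P" "finite ?Q" using finite_between sE D by auto
  have XD: "X \<subseteq> D" using XE D by auto
  have cP: "real (card ?P) = \<theta>"
    using card_between[OF X(1) sE(1) XE(1), of "t + 1"] X hG t_le by (simp add: \<theta>_def Suc_diff_le)
  have cQ: "real (card ?Q) = gb (k - t) 1"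
    using card_between[OF X(1) D(1) XD, of "t + 1"] X D by simp
  have "real (card {F \<in> \<F>. X \<subseteq> F}) \<le> (\<Sum>S\<in>?P. deg S)"
    using deg_le_sum_extension[OF X(1) XE(1) sE(1)] member_meets_join[OF X _ _ G(1) hG(1)] X
    unfolding deg_def[of X] by auto
  also have "\<dots> = (\<Sum>S\<in>?Q. deg S) + (\<Sum>S\<in>?P - ?Q. deg S)"
    using sum.subset_diff[OF QP fP(1), of deg] by simp
  also have "\<dots> \<le> (\<Sum>S\<in>?Q. A) + (\<Sum>S\<in>?P - ?Q. \<theta> * B)"
  proof (intro add_mono sum_mono)
    fix S assume "S \<in> ?Q"
    then show "deg S \<le> A" using D unfolding between_def by (intro deg_le_A) auto
  next
    fix S assume S: "S \<in> ?P - ?Q"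
    then have S': "sbs S" "dim S = t + 1" "X \<subseteq> S" "\<not> S \<subseteq> D" using sE unfolding between_def by auto
    have "\<not> cover S"
    proof
      assume "cover S"
      then have "S \<subseteq> ?E" "S \<subseteq> ?E'"
        using hyperplane_of_cover(2)[OF X S'(1) _ S'(2,3)] G H by auto
      then show False using S' D by auto
    qed
    then show "deg S \<le> \<theta> * B" using deg_noncover_t1 S' by blast
  qed
  also have "\<dots> = gb (k - t) 1 * A + (\<theta> - gb (k - t) 1) * (\<theta> * B)"
    using cP cQ fP QP by (simp add: card_Diff_subset card_mono of_nat_diff)
  finally have through: "real (card {F \<in> \<F>. X \<subseteq> F})
      \<le> gb (k - t) 1 * A + (\<theta> - gb (k - t) 1) * (\<theta> * B)" .

  let ?Z = "join T U"
  have sZ: "sbs ?Z" using T U sbs_join by blast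
  have TU: "T \<inter> U = X"
  proof -
    have sTU: "sbs (T \<inter> U)" using T U sbs_Int by blast
    have "\<not> t + 1 \<le> dim (T \<inter> U)"
      using sbs_eqI[OF T(1), of "T \<inter> U"] sbs_eqI[OF U(1), of T] T U sTU by (metis Int_lower1 inf.absorb_iff1 order_refl)
    then show ?thesis using sbs_eqI[OF sTU, of X] X T U by auto
  qed
  have dZ: "dim ?Z = t + 2" using dim_join[OF T(1) U(1)] TU T U X by simp
  have XZ: "X \<subseteq> ?Z" using T join_upper(1)[of T U] by auto
  let ?R = "between {0} ?Z (t + 1)" and ?R' = "between X ?Z (t + 1)"
  have fR: "finite ?R" "finite ?R'" using finite_between sZ by auto
  have "real (card {F \<in> \<F>. \<not> X \<subseteq> F}) \<le> (\<Sum>S\<in>?R - ?R'. deg S)"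
  proof (rule card_le_sum_deg)
    fix F assume F: "F \<in> \<F>" "\<not> X \<subseteq> F"
    have sF: "sbs F" using \<F>_sub F by auto
    have sI: "sbs (T \<inter> F)" "sbs (U \<inter> F)" "sbs (F \<inter> ?Z)" using sF T U sZ by (auto intro: subspace_inter)
    have tI: "t \<le> dim (T \<inter> F)" "t \<le> dim (U \<inter> F)" using T U F unfolding cover_def by auto
    have TZ: "T \<inter> F \<subseteq> F \<inter> ?Z" "U \<inter> F \<subseteq> F \<inter> ?Z" using join_upper(1)[of T U] join_upper(2)[of U T] by auto
    \<comment> \<open>Otherwise T \<inter> F and U \<inter> F are the same t-space, which then lies
      in T \<inter> U = X and equals X, so that F contains X.\<close>
    have "t + 1 \<le> dim (F \<inter> ?Z)"
    proof (rule ccontr)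
      assume c: "\<not> t + 1 \<le> dim (F \<inter> ?Z)"
      then have "T \<inter> F = F \<inter> ?Z" "U \<inter> F = F \<inter> ?Z"
        using sbs_eqI[OF sI(3)] sI tI TZ by auto
      then have "T \<inter> F \<subseteq> X" using TU by auto
      then have "T \<inter> F = X" using sbs_eqI[OF X(1), of "T \<inter> F"] sI tI X by auto
      then show False using F by auto
    qed
    then obtain W where W: "sbs W" "W \<subseteq> F \<inter> ?Z" "dim W = t + 1"
      using exists_between[OF sI(3), of "{0}" "t + 1"] sbs_0 subspace_0 sI by auto
    then have "\<not> X \<subseteq> W" using F by auto
    then have "W \<in> ?R - ?R'" using W subspace_0 unfolding between_def by auto
    then show "\<exists>S\<in>?R - ?R'. S \<subseteq> F" using W by blast
  qed (use fR in simp)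
  also have "\<dots> \<le> (\<Sum>S\<in>?R - ?R'. \<theta> * B)"
  proof (rule sum_mono)
    fix S assume "S \<in> ?R - ?R'"
    then have S: "sbs S" "dim S = t + 1" "\<not> X \<subseteq> S" using sZ unfolding between_def by auto
    then show "deg S \<le> \<theta> * B" using deg_noncover_t1 all by blast
  qed
  also have "\<dots> = (gb (t + 2) 1 - gb 2 1) * (\<theta> * B)"
  proof -
    have "?R' \<subseteq> ?R" unfolding between_def using subspace_0 by auto
    moreover have "real (card ?R) = gb (t + 2) 1"
      using card_subspaces[OF sZ, of "t + 1"] dZ gb_hyperplanes[of "t + 1"] by simp
    moreover have "real (card ?R') = gb 2 1"
      using card_between[OF X(1) sZ XZ, of "t + 1"] X dZ by simp
    ultimately show ?thesis using fR by (simp add: card_Diff_subset card_mono of_nat_diff)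
  qed
  finally have rest: "real (card {F \<in> \<F>. \<not> X \<subseteq> F}) \<le> (gb (t + 2) 1 - gb 2 1) * (\<theta> * B)" .
  have "\<F> = {F \<in> \<F>. X \<subseteq> F} \<union> {F \<in> \<F>. \<not> X \<subseteq> F}" by auto
  then have "card \<F> \<le> card {F \<in> \<F>. X \<subseteq> F} + card {F \<in> \<F>. \<not> X \<subseteq> F}" by (metis card_Un_le)
  then show ?thesis using through rest by linarith
qed

proposition family_cases:
  obtains
    (H3) Z where "sbs Z" "dim Z = t + 2" "\<And>F. F \<in> \<F> \<Longrightarrow> t + 1 \<le> dim (F \<inter> Z)"
  | (H1) X M where "sbs X" "dim X = t" "sbs M" "dim M = k + 1" "X \<subseteq> M"
      "\<And>F. F \<in> \<F> \<Longrightarrow> X \<subseteq> F \<Longrightarrow> t + 1 \<le> dim (F \<inter> M)" "\<And>F. F \<in> \<F> \<Longrightarrow> \<not> X \<subseteq> F \<Longrightarrow> F \<subseteq> M"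
  | (unique) "real (card \<F>) \<le> A + gb (t + 1) 1 * ((\<theta> - 1) * (\<theta> * B))"
  | (pencil) "real (card \<F>) \<le> gb (k - t) 1 * A + (\<theta> - gb (k - t) 1) * (\<theta> * B)
      + (gb (t + 2) 1 - gb 2 1) * (\<theta> * B)"
  | (none) m where "t + 2 \<le> m" "m \<le> k" "real (card \<F>) \<le> gb m t * \<theta> ^ (m - t) * gb (n - m) (k - m)"
proof -
  consider (0) "\<And>S. sbs S \<Longrightarrow> cover S \<Longrightarrow> dim S \<noteq> t + 1"
    | (1) T where "sbs T" "cover T" "dim T = t + 1" "\<And>S. sbs S \<Longrightarrow> cover S \<Longrightarrow> dim S = t + 1 \<Longrightarrow> S = T"
    | (2) T U where "sbs T" "cover T" "dim T = t + 1" "sbs U" "cover U" "dim U = t + 1" "T \<noteq> U"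
    by blast
  then show thesis
  proof cases
    case 0
    then show ?thesis using card_le_min_cover none by blast
  next
    case 1
    then show ?thesis using card_le_unique_cover unique by blast
  next
    case 2
    show ?thesis
    proof (cases "\<exists>W. sbs W \<and> cover W \<and> dim W = t + 1 \<and> \<not> T \<inter> U \<subseteq> W")
      case True
      then obtain W where W: "sbs W" "cover W" "dim W = t + 1" "\<not> T \<inter> U \<subseteq> W" by blast
      note three_covers[OF 2(1-3,4-6,7) W]
      then show ?thesis using H3[of "join T U"] sbs_join 2 by blast
    next
      case False
      let ?X = "T \<inter> U"
      have sX: "sbs ?X" using 2 sbs_Int by blast
      have "\<not> t + 1 \<le> dim ?X"
        using sbs_eqI[OF 2(1), of ?X] sbs_eqI[OF 2(4), of T] 2 sX by (metis Int_lower1 inf.absorb_iff1 order_refl)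
      then have dX: "dim ?X = t" using covers_meet[OF 2(1-6)] by simp
      obtain G where G: "G \<in> \<F>" "\<not> ?X \<subseteq> G" using nontrivial[OF sX dX] by blast
      show ?thesis
      proof (cases "\<exists>H\<in>\<F>. \<not> ?X \<subseteq> H \<and> \<not> H \<subseteq> join G ?X")
        case True
        then show ?thesis
          using card_le_pencil_of_covers[OF sX dX 2(1-3) _ 2(4-6) _ 2(7) _ G] False pencil by blast
      next
        case no: False
        note hG = hyperplane_of_cover[OF sX dX 2(1-3) _ G]
        show ?thesis
        proof (rule H1[OF sX dX])
          show "sbs (join G ?X)" using sX \<F>_sub[OF G(1)] sbs_join by blast
          show "dim (join G ?X) = k + 1" using hG by blast
          show "?X \<subseteq> join G ?X" by (rule join_upper)
          fix F assume F: "F \<in> \<F>"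
          show "t + 1 \<le> dim (F \<inter> join G ?X)" if "?X \<subseteq> F"
            using member_meets_join[OF sX dX F that G(1)] hG by blast
          show "F \<subseteq> join G ?X" if "\<not> ?X \<subseteq> F" using no F that by blast
        qed
      qed
    qed
  qed
qed

end

section \<open>Sizes of the two extremal families and the conclusion\<close>

context fin_vector_space
begin

lemma subspaces_of_dim_eq_between: "subspaces_of_dim scale W d = between {0} W d"
  unfolding subspaces_of_dim_def between_def using subspace_0 by auto

lemma in_subspaces_of_dim: "F \<in> subspaces_of_dim scale V d \<longleftrightarrow> sbs F \<and> dim F = d"
  unfolding subspaces_of_dim_def by auto

text \<open>Sort the members by F \<inter> Z, which is Z itself or one of its [t+2,1] hyperplanes W.
  The members over W are the k-spaces through W that do not contain Z.\<close>

lemma card_H3: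
  assumes Z: "Z \<in> subspaces_of_dim scale V (t + 2)" and "t + 2 \<le> k" and n: "dim V = n"
  shows "real (card (H3 scale V k t Z))
    = gb (t + 2) 1 * gb (n - (t + 1)) (k - (t + 1)) - Q * gb (t + 1) 1 * gb (n - (t + 2)) (k - (t + 2))"
proof -
  have sV: "sbs V" using subspace_V by simp
  have sZ: "sbs Z" "dim Z = t + 2" "Z \<subseteq> V" using Z in_subspaces_of_dim by auto
  let ?D = "between {0} Z (t + 1)" and ?a = "gb (n - (t + 1)) (k - (t + 1))" and ?b = "gb (n - (t + 2)) (k - (t + 2))"
  have eq: "H3 scale V k t Z = between Z V k \<union> (\<Union>W\<in>?D. meeting W Z V k)"
  proof (intro set_eqI iffI)
    fix F assume "F \<in> H3 scale V k t Z"
    then have F: "sbs F" "dim F = k" "t + 1 \<le> dim (F \<inter> Z)"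
      unfolding H3_def using in_subspaces_of_dim by auto
    have sI: "subspace (F \<inter> Z)" using F sZ subspace_inter by auto
    show "F \<in> between Z V k \<union> (\<Union>W\<in>?D. meeting W Z V k)"
    proof (cases "Z \<subseteq> F")
      case True
      then show ?thesis using F unfolding between_def by auto
    next
      case False
      then have "\<not> t + 2 \<le> dim (F \<inter> Z)" using sbs_eqI[OF sZ(1) sI] sZ by auto
      then have "F \<inter> Z \<in> ?D" using F sI subspace_0 unfolding between_def by auto
      moreover have "F \<in> meeting (F \<inter> Z) Z V k" using F unfolding meeting_def by auto
      ultimately show ?thesis by blast
    qed
  next
    fix F assume "F \<in> between Z V k \<union> (\<Union>W\<in>?D. meeting W Z V k)"
    then consider "F \<in> between Z V k" | W where "W \<in> ?D" "F \<in> meeting W Z V k" by blast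
    then show "F \<in> H3 scale V k t Z"
    proof cases
      case 1
      moreover from this have "F \<inter> Z = Z" unfolding between_def by auto
      ultimately show ?thesis unfolding between_def H3_def subspaces_of_dim_def using sZ by auto
    next
      case 2
      then show ?thesis unfolding between_def meeting_def H3_def subspaces_of_dim_def by auto
    qed
  qed
  have fin: "finite ?D" "finite (between Z V k)" "\<And>W. finite (meeting W Z V k)"
    using finite_between finite_meeting sZ sV by auto
  have cb: "real (card (between Z V k)) = ?b" using card_between[OF sZ(1) sV] sZ n assms(2) by simp
  have cm: "real (card (meeting W Z V k)) = ?a - ?b" if "W \<in> ?D" for W
  proof -
    have W: "sbs W" "dim W = t + 1" "W \<subseteq> Z" using that sZ unfolding between_def by auto
    have "between W V k = meeting W Z V k \<union> between Z V k"
    proof (intro set_eqI iffI)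
      fix F assume "F \<in> between W V k"
      then have F: "sbs F" "dim F = k" "W \<subseteq> F" unfolding between_def by auto
      have sI: "sbs (F \<inter> Z)" using F sZ by (auto intro: subspace_inter)
      show "F \<in> meeting W Z V k \<union> between Z V k"
      proof (cases "Z \<subseteq> F")
        case False
        then have "\<not> t + 2 \<le> dim (F \<inter> Z)" using sbs_eqI[OF sZ(1), of "F \<inter> Z"] sI sZ by auto
        then have "W = F \<inter> Z" using W F by (intro sbs_eqI[OF sI]) auto
        then show ?thesis using F unfolding meeting_def by auto
      qed (use F in \<open>auto simp: between_def\<close>)
    next
      fix F assume "F \<in> meeting W Z V k \<union> between Z V k"
      then show "F \<in> between W V k" using W unfolding meeting_def between_def by auto
    qed
    moreover have "meeting W Z V k \<inter> between Z V k = {}"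
      using W sZ unfolding meeting_def between_def by (auto simp: Int_absorb1)
    ultimately have "card (between W V k) = card (meeting W Z V k) + card (between Z V k)"
      using fin by (simp add: card_Un_disjoint)
    moreover have "real (card (between W V k)) = ?a"
      using card_between[OF W(1) sV] W sZ n assms(2) by simp
    ultimately show ?thesis using cb by simp
  qed
  have "card (H3 scale V k t Z) = card (between Z V k) + card (\<Union>W\<in>?D. meeting W Z V k)"
    unfolding eq
  proof (rule card_Un_disjoint)
    show "between Z V k \<inter> (\<Union>W\<in>?D. meeting W Z V k) = {}"
    proof (rule ccontr)
      assume "between Z V k \<inter> (\<Union>W\<in>?D. meeting W Z V k) \<noteq> {}"
      then obtain F W where FW: "F \<in> between Z V k" "W \<in> ?D" "F \<in> meeting W Z V k" by blast
      have "F \<inter> Z = Z" using FW(1) unfolding between_def by auto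
      moreover have "F \<inter> Z = W" using FW(3) unfolding meeting_def by auto
      moreover have "dim W = t + 1" using FW(2) unfolding between_def by auto
      ultimately show False using sZ by simp
    qed
  qed (use fin in auto)
  also have "card (\<Union>W\<in>?D. meeting W Z V k) = (\<Sum>W\<in>?D. card (meeting W Z V k))"
    using fin by (intro card_UN_disjoint) (auto simp: meeting_def)
  finally have "real (card (H3 scale V k t Z)) = ?b + (\<Sum>W\<in>?D. real (card (meeting W Z V k)))"
    using cb by simp
  also have "\<dots> = ?b + gb (t + 2) 1 * (?a - ?b)"
    using cm card_subspaces[OF sZ(1), of "t + 1"] sZ gb_hyperplanes[of "t + 1"] by simp
  also have "gb (t + 2) 1 = Q * gb (t + 1) 1 + 1" using gb_1_Suc[of "t + 1"] by simp
  finally show ?thesis using gb_1_Suc[of "t + 1"] by (simp add: algebra_simps)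
qed

text \<open>A k-subspace of M through X already satisfies the first condition because k \<ge> t + 1,
  so splitting by X \<subseteq> F makes the union disjoint. The part without X has [k+1,1] -
  [k+1-t,1] = q^(k+1-t) [t,1] elements.\<close>

lemma card_H1:
  assumes X: "X \<in> subspaces_of_dim scale V t" and M: "M \<in> subspaces_of_dim scale V (k + 1)"
    and "X \<subseteq> M" and "t + 1 \<le> k" and n: "dim V = n"
  shows "real (card (H1 scale V k t X M)) = gb (n - t) (k - t)
    - Q ^ ((k + 1 - t) * (k - t)) * gb (n - (k + 1)) (k - t) + Q ^ (k + 1 - t) * gb t 1"
proof -
  have sV: "sbs V" using subspace_V by simp
  have sX: "sbs X" "dim X = t" and sM: "sbs M" "dim M = k + 1" using X M in_subspaces_of_dim by auto
  have eq: "H1 scale V k t X M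
    = (between X V k - meeting X M V k) \<union> (between {0} M k - between X M k)"
  proof (intro set_eqI iffI)
    fix F assume F: "F \<in> H1 scale V k t X M"
    show "F \<in> (between X V k - meeting X M V k) \<union> (between {0} M k - between X M k)"
    proof (cases "X \<subseteq> F")
      case True
      have "F \<inter> M \<noteq> X \<and> sbs F \<and> dim F = k"
      proof (cases "F \<subseteq> M")
        case True
        then have "sbs F \<and> dim F = k" "F \<inter> M = F" using F sM unfolding H1_def subspaces_of_dim_def by auto
        then show ?thesis using sX assms(4) by auto
      next
        case False
        then show ?thesis using F sX unfolding H1_def subspaces_of_dim_def by auto
      qed
      then show ?thesis using True unfolding between_def meeting_def by auto
    next
      case False
      then show ?thesis using F subspace_0 unfolding H1_def subspaces_of_dim_def between_def by auto
    qed
  next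
    fix F assume "F \<in> (between X V k - meeting X M V k) \<union> (between {0} M k - between X M k)"
    then consider "F \<in> between X V k - meeting X M V k" | "F \<in> between {0} M k" by blast
    then show "F \<in> H1 scale V k t X M"
    proof cases
      case 1
      then have F: "sbs F" "dim F = k" "X \<subseteq> F" "F \<inter> M \<noteq> X" unfolding between_def meeting_def by auto
      have sI: "sbs (F \<inter> M)" using F sM by (auto intro: subspace_inter)
      have "\<not> dim (F \<inter> M) \<le> t" using sbs_eqI[OF sI, of X] sX F \<open>X \<subseteq> M\<close> by auto
      then show ?thesis using F unfolding H1_def subspaces_of_dim_def by auto
    next
      case 2
      then show ?thesis unfolding H1_def subspaces_of_dim_def between_def by auto
    qed
  qed
  have fin: "finite (between X V k)" "finite (between {0} M k)" "finite (between X M k)" "finite (meeting X M V k)"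
    using finite_between finite_meeting sM sV by auto
  have sub: "meeting X M V k \<subseteq> between X V k" "between X M k \<subseteq> between {0} M k"
    unfolding meeting_def between_def using subspace_0 by auto
  have "card (H1 scale V k t X M)
      = card (between X V k - meeting X M V k) + card (between {0} M k - between X M k)"
    unfolding eq by (rule card_Un_disjoint) (use fin in \<open>auto simp: between_def\<close>)
  moreover have "real (card (between X V k - meeting X M V k))
      = real (card (between X V k)) - real (card (meeting X M V k))"
    using fin sub by (simp add: card_Diff_subset of_nat_diff card_mono)
  moreover have "real (card (between {0} M k - between X M k))
      = real (card (between {0} M k)) - real (card (between X M k))"
    using fin sub by (simp add: card_Diff_subset of_nat_diff card_mono)
  moreover have "real (card (between X V k)) = gb (n - t) (k - t)"
    using card_between[OF sX(1) sV] sX n assms(4) by simp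
  moreover have "real (card (meeting X M V k)) = Q ^ ((k + 1 - t) * (k - t)) * gb (n - (k + 1)) (k - t)"
    using card_meeting[OF sX(1) sM(1) sV \<open>X \<subseteq> M\<close>, of "k - t"] sM sX n assms(4) by simp
  moreover have "real (card (between {0} M k)) = qint (k + 1)"
    using card_subspaces[OF sM(1), of k] sM gb_hyperplanes[of k] unfolding qint_def by simp
  moreover have "real (card (between X M k)) = qint (k + 1 - t)"
    using card_between[OF sX(1) sM(1) \<open>X \<subseteq> M\<close>, of k] sM sX assms(4) gb_hyperplanes[of "k - t"]
    unfolding qint_def by (simp add: Suc_diff_le)
  moreover have "qint (k + 1) = qint (k + 1 - t) + Q ^ (k + 1 - t) * qint t"
    using qint_add[of "k + 1 - t" t] assms(4) by simp
  ultimately show ?thesis unfolding qint_def by simp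
qed

text \<open>The conclusion speaks of containment because the family need not be maximal; equality is
  decided later by cardinality. The comparison of \<open>h1\<close> with \<open>h3\<close> is
  included because the parameters p and l in which it is proved are introduced here.\<close>

theorem nontrivial_family_cases:
  assumes n: "dim V = n" and t: "0 < t" "t + 2 \<le> k" and nk: "2 * k + t + min 4 (2 * t) \<le> n"
    and \<F>: "\<F> \<subseteq> subspaces_of_dim scale V k" "t_intersecting scale t \<F>" "\<not> trivial_family scale V t \<F>"
    and h1: "h1 = gb (n - t) (k - t) - Q ^ ((k + 1 - t) * (k - t)) * gb (n - (k + 1)) (k - t)
        + Q ^ (k + 1 - t) * gb t 1"
    and h3: "h3 = gb (t + 2) 1 * gb (n - (t + 1)) (k - (t + 1))
        - Q * gb (t + 1) 1 * gb (n - (t + 2)) (k - (t + 2))"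
  shows "((\<exists>Z\<in>subspaces_of_dim scale V (t + 2). \<F> \<subseteq> H3 scale V k t Z)
      \<or> (\<exists>X\<in>subspaces_of_dim scale V t. \<exists>M\<in>subspaces_of_dim scale V (k + 1). X \<subset> M \<and> \<F> \<subseteq> H1 scale V k t X M)
      \<or> (2 * t + 2 \<le> k \<longrightarrow> real (card \<F>) < h1) \<and> (k < 2 * t + 2 \<longrightarrow> real (card \<F>) < h3))
    \<and> (2 * t + 2 \<le> k \<longrightarrow> h3 < h1) \<and> (k < 2 * t + 2 \<longrightarrow> (if (t, k) = (1, 3) then h1 = h3 else h1 < h3))"
proof -
  define p where "p = k - t - 2"
  define l where "l = n - k"
  have k: "k = t + p + 2" and n': "n = t + p + 2 + l" using t nk unfolding p_def l_def by auto
  interpret sz: size_bounds q t p l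
  proof
    show "0 < t" by fact
    show "p + 2 + 2 * t + min 4 (2 * t) \<le> l" using nk k n' by linarith
  qed
  have H1: "h1 = sz.h1" unfolding h1 sz.h1_def qint_def k n' by (simp add: numeral_3_eq_3)
  have H3: "h3 = sz.h3" unfolding h3 sz.h3_def qint_def sz.a_def sz.b_def k n' by simp

  \<comment> \<open>V has finitely many k-subspaces, so some maximal t-intersecting family contains
    \<open>\<F>\<close>. It stays non-trivial, because the member of \<open>\<F>\<close> not
    containing a given t-space still belongs to it.\<close>
  let ?I = "{\<G>. \<G> \<subseteq> subspaces_of_dim scale V k \<and> t_intersecting scale t \<G>}"
  have "finite (subspaces_of_dim scale V k)"
    unfolding subspaces_of_dim_eq_between using subspace_V by (intro finite_between) simp
  then have "finite ?I" by simp
  moreover have "\<F> \<in> ?I" using \<F> by simp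
  ultimately have "\<exists>\<G>\<in>?I. \<F> \<subseteq> \<G> \<and> (\<forall>\<H>\<in>?I. \<G> \<subseteq> \<H> \<longrightarrow> \<G> = \<H>)"
    by (rule finite_has_maximal2)
  then obtain \<G> where \<G>: "\<G> \<in> ?I" "\<F> \<subseteq> \<G>" and max: "\<forall>\<H>\<in>?I. \<G> \<subseteq> \<H> \<longrightarrow> \<G> = \<H>"
    by (elim bexE conjE)
  have members: "sbs F \<and> dim F = k" if "F \<in> \<G>" for F
    using \<G>(1) that in_subspaces_of_dim by blast
  interpret fam: intersecting_family scale V q n k t \<G>
  proof unfold_locales
    show "2 * k + t + 2 \<le> n" using nk t by (simp add: min_def split: if_splits)
    show "sbs F \<and> dim F = k" if "F \<in> \<G>" for F using members that .
    show "t \<le> dim (F \<inter> G)" if "F \<in> \<G>" "G \<in> \<G>" for F G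
      using \<G>(1) that unfolding t_intersecting_def by blast
    show "G \<in> \<G>" if G: "sbs G" "dim G = k" and Gt: "\<And>F. F \<in> \<G> \<Longrightarrow> t \<le> dim (G \<inter> F)" for G
    proof -
      have "t_intersecting scale t (insert G \<G>)"
        unfolding t_intersecting_def
      proof (intro ballI)
        fix A B assume AB: "A \<in> insert G \<G>" "B \<in> insert G \<G>"
        show "t \<le> dim (A \<inter> B)"
        proof (cases "A = G")
          case True
          then show ?thesis using AB Gt[of B] G t by (cases "B = G") auto
        next
          case False
          then show ?thesis using AB Gt[of A] \<G>(1) unfolding t_intersecting_def
            by (cases "B = G") (auto simp: Int_commute)
        qed
      qed
      then have "insert G \<G> \<in> ?I" using \<G>(1) G in_subspaces_of_dim by auto
      with max have "\<G> = insert G \<G>" by (meson subset_insertI)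
      then show ?thesis by blast
    qed
    show "\<exists>F\<in>\<G>. \<not> X \<subseteq> F" if "sbs X" "dim X = t" for X
    proof -
      have "X \<in> subspaces_of_dim scale V t" using that in_subspaces_of_dim by simp
      then obtain F where "F \<in> \<F>" "\<not> X \<subseteq> F" using \<F>(3) unfolding trivial_family_def by blast
      then show ?thesis using \<G>(2) by blast
    qed
  qed (use n t in simp_all)
  have cards: "card \<F> \<le> card \<G>" using \<G>(2) fam.finite_\<F> by (rule card_mono[rotated])
  have A: "fam.A = sz.a" and B: "fam.B = sz.b"
  proof -
    have "n - (t + 1) = p + 1 + l" "k - (t + 1) = p + 1" "n - (t + 2) = p + l" "k - (t + 2) = p"
      using k n' by auto
    then show "fam.A = sz.a" "fam.B = sz.b" unfolding fam.A_def sz.a_def fam.B_def sz.b_def by simp_all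
  qed
  have \<theta>: "fam.\<theta> = sz.\<theta>" "gb (k - t) 1 = sz.\<mu>"
  proof -
    have "k - t + 1 = p + 3" "k - t = p + 2" using k by auto
    then show "fam.\<theta> = sz.\<theta>" "gb (k - t) 1 = sz.\<mu>"
      unfolding fam.\<theta>_def sz.\<theta>_def sz.\<mu>_def qint_def by (simp_all only:)
  qed

  have large: "2 * t + 2 \<le> k \<longleftrightarrow> t \<le> p" and small: "k < 2 * t + 2 \<longleftrightarrow> p + 1 \<le> t"
    using k by auto
  have "h3 < h1" if "t \<le> p" using sz.h3_less_h1[OF that] H1 H3 by simp
  moreover have "if (t, k) = (1, 3) then h1 = h3 else h1 < h3" if "p + 1 \<le> t"
  proof (cases "(t, k) = (1, 3)")
    case True
    then show ?thesis using sz.h1_eq_h3[OF that] H1 H3 by simp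
  next
    case False
    then have "p + 1 < t \<or> 1 < t" using k t that by auto
    then show ?thesis using sz.h1_less_h3[OF that] H1 H3 False by (simp only: if_False)
  qed
  ultimately have cmp: "(2 * t + 2 \<le> k \<longrightarrow> h3 < h1)
      \<and> (k < 2 * t + 2 \<longrightarrow> (if (t, k) = (1, 3) then h1 = h3 else h1 < h3))"
    unfolding large small by blast

  \<comment> \<open>Handles the three cases that yield only a numerical bound s, which lies below
    \<open>h1\<close> in the first range and below \<open>h3\<close> in the second.\<close>
  have small_card: ?thesis
    if s: "real (card \<G>) \<le> s" "t \<le> p \<Longrightarrow> s < sz.h1" "p + 1 \<le> t \<Longrightarrow> s < sz.h3" for s
  proof -
    have "real (card \<F>) \<le> s" using cards s(1) by simp
    then have "(2 * t + 2 \<le> k \<longrightarrow> real (card \<F>) < h1) \<and> (k < 2 * t + 2 \<longrightarrow> real (card \<F>) < h3)"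
      unfolding large small H1 H3 using s(2,3) by force
    then show ?thesis using cmp by blast
  qed
  show ?thesis
  proof (cases rule: fam.family_cases)
    case (H3 Z)
    have "Z \<in> subspaces_of_dim scale V (t + 2)" using H3 in_subspaces_of_dim by blast
    moreover have "\<F> \<subseteq> H3 scale V k t Z"
    proof
      fix F assume "F \<in> \<F>"
      then have "F \<in> \<G>" using \<G>(2) by blast
      then show "F \<in> H3 scale V k t Z"
        unfolding H3_def using members[of F] H3(3)[of F] in_subspaces_of_dim by simp
    qed
    ultimately show ?thesis using cmp by blast
  next
    case (H1 X M)
    have "X \<in> subspaces_of_dim scale V t" "M \<in> subspaces_of_dim scale V (k + 1)"
      using H1 in_subspaces_of_dim by blast+
    moreover have "X \<subset> M" using H1(2,4,5) t by auto
    moreover have "\<F> \<subseteq> H1 scale V k t X M"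
    proof
      fix F assume "F \<in> \<F>"
      then have F: "F \<in> \<G>" using \<G>(2) by blast
      show "F \<in> H1 scale V k t X M"
      proof (cases "X \<subseteq> F")
        case True
        then show ?thesis unfolding H1_def using members[OF F] H1(6)[OF F] in_subspaces_of_dim by simp
      next
        case False
        then show ?thesis
          unfolding H1_def using members[OF F] H1(7)[OF F] by (simp add: subspaces_of_dim_def)
      qed
    qed
    ultimately show ?thesis using cmp by blast
  next
    case unique
    then have "real (card \<G>) \<le> sz.unique_size" unfolding sz.unique_size_def A B \<theta> qint_def .
    then show ?thesis by (rule small_card) (fact sz.unique_size_less_h1 sz.unique_size_less_h3)+
  next
    case pencil
    then have "real (card \<G>) \<le> sz.pencil_size" unfolding sz.pencil_size_def A B \<theta> qint_def .
    then show ?thesis by (rule small_card) (fact sz.pencil_size_less_h1 sz.pencil_size_less_h3)+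
  next
    case (none m)
    have "n - m = t + p + 2 + l - m" "k - m = t + p + 2 - m" using k n' by auto
    then have "real (card \<G>) \<le> sz.none_size m" using none(3) unfolding sz.none_size_def \<theta>(1) by simp
    moreover have "m \<le> t + p + 2" using none k by simp
    note sz.none_size_less_h1[OF _ none(1) this] sz.none_size_less_h3[OF _ none(1) this]
    ultimately show ?thesis by (rule small_card)
  qed
qed

end

text \<open>An infinite-dimensional V would have dimension 0 by convention; a positive dimension
  thus gives a finite basis, whose span is finite over a finite field.\<close>

lemma finite_if_dim_pos:
  fixes scale :: "'k::{field,finite} \<Rightarrow> 'v::ab_group_add \<Rightarrow> 'v"
  assumes "vector_space scale" "0 < vector_space.dim scale V"
  shows "finite V"
proof -
  interpret vs: vector_space scale by fact
  \<comment> \<open>\<open>card_span_independent\<close> does not involve the chosen subspace, so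
    the zero space suffices as an instance.\<close>
  interpret line: fin_vector_space scale "{0}" "CARD('k)"
    by unfold_locales simp_all
  obtain B where B: "B \<subseteq> V" "vs.independent B" "V \<subseteq> vs.span B" "card B = vs.dim V"
    using vs.basis_exists by blast
  then have "finite B" using assms(2) by (metis card.infinite less_nat_zero_code)
  then have "finite (vs.span B)" using line.card_span_independent B by blast
  then show ?thesis using B finite_subset by blast
qed

theorem theorem1p2:
  fixes scale :: "'k::{field,finite} \<Rightarrow> 'v::ab_group_add \<Rightarrow> 'v"
    and V :: "'v set" and \<F> :: "'v set set" and q n k t :: nat
  assumes "vector_space scale"
    and "q = CARD('k)"
    and "n > 0" and "k > 0" and "t > 0"
    and "int t \<le> int k - 2"
    and "2 * k + t + min 4 (2 * t) \<le> n"
    and "module.subspace scale V" and "vector_space.dim scale V = n"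
    and "\<F> \<subseteq> subspaces_of_dim scale V k"
    and "t_intersecting scale t \<F>"
    and "\<not> trivial_family scale V t \<F>"
  shows
    "(1 \<le> t \<and> real t \<le> real k / 2 - 1 \<longrightarrow>
       (let bound = gauss_binomial q (int n - int t) (int k - int t)
              - real q ^ ((k + 1 - t) * (k - t)) * gauss_binomial q (int n - int k - 1) (int k - int t)
              + real q ^ (k + 1 - t) * gauss_binomial q (int t) 1
        in real (card \<F>) \<le> bound \<and>
           (real (card \<F>) = bound \<longleftrightarrow>
             (\<exists>X \<in> subspaces_of_dim scale V t.
              \<exists>M \<in> subspaces_of_dim scale V (k + 1).
                X \<subset> M \<and> \<F> = H1 scale V k t X M))))
     \<and>
     (real k / 2 - 1 < real t \<and> int t \<le> int k - 2 \<longrightarrow>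
       (let bound = gauss_binomial q (int t + 2) 1
                * gauss_binomial q (int n - int t - 1) (int k - int t - 1)
              - real q * gauss_binomial q (int t + 1) 1
                * gauss_binomial q (int n - int t - 2) (int k - int t - 2)
        in real (card \<F>) \<le> bound \<and>
           (real (card \<F>) = bound \<longleftrightarrow>
             (\<exists>Z \<in> subspaces_of_dim scale V (t + 2).
                \<F> = H3 scale V k t Z)
             \<or> ((t, k) = (1, 3) \<and>
                (\<exists>X \<in> subspaces_of_dim scale V 1.
                 \<exists>M \<in> subspaces_of_dim scale V 4.
                   X \<subset> M \<and> \<F> = H1 scale V k t X M)))))"
proof -
  interpret vs: vector_space scale by fact
  have fin_V: "finite V" using finite_if_dim_pos[OF assms(1), of V] assms(3,9) by simp
  interpret fin_vector_space scale V q
    by unfold_locales (use assms fin_V in simp_all)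
  have t2: "t + 2 \<le> k" using assms(6) by linarith
  define h1 where "h1 = gb (n - t) (k - t) - Q ^ ((k + 1 - t) * (k - t)) * gb (n - (k + 1)) (k - t)
    + Q ^ (k + 1 - t) * gb t 1"
  define h3 where "h3 = gb (t + 2) 1 * gb (n - (t + 1)) (k - (t + 1))
    - Q * gb (t + 1) 1 * gb (n - (t + 2)) (k - (t + 2))"
  note cases = nontrivial_family_cases[OF assms(9,5) t2 assms(7,10,11,12) h1_def h3_def]
  have card3: "real (card (H3 scale V k t Z)) = h3" if "Z \<in> subspaces_of_dim scale V (t + 2)" for Z
    using card_H3[OF that t2 assms(9)] h3_def by simp
  have card1: "real (card (H1 scale V k t X M)) = h1"
    if "X \<in> subspaces_of_dim scale V t" "M \<in> subspaces_of_dim scale V (k + 1)" "X \<subset> M" for X M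
    using card_H1[OF that(1,2) _ _ assms(9)] that(3) t2 h1_def by auto
  have finite_k: "finite (subspaces_of_dim scale W k)" if "W \<in> subspaces_of_dim scale V d" for W d
    unfolding subspaces_of_dim_eq_between using that in_subspaces_of_dim by (intro finite_between) blast
  have V: "V \<in> subspaces_of_dim scale V n" using in_subspaces_of_dim subspace_V assms(9) by simp
  \<comment> \<open>A subset of a finite set with the same cardinality is the whole set; this turns
    containment in an extremal family into the characterisation of equality.\<close>
  have sub: "real (card \<F>) \<le> real (card \<H>) \<and> (real (card \<F>) = real (card \<H>) \<longrightarrow> \<F> = \<H>)"
    if "\<F> \<subseteq> \<H>" "finite \<H>" for \<H>
    using card_mono[OF that(2,1)] card_subset_eq[OF that(2,1)] by simp
  have fin3: "finite (H3 scale V k t Z)" for Z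
    unfolding H3_def using finite_k[OF V] by simp
  have fin1: "finite (H1 scale V k t X M)" if "M \<in> subspaces_of_dim scale V (k + 1)" for X M
    unfolding H1_def using finite_k[OF V] finite_k[OF that] by simp
  let ?in3 = "\<exists>Z\<in>subspaces_of_dim scale V (t + 2). \<F> = H3 scale V k t Z"
  let ?in1 = "\<exists>X\<in>subspaces_of_dim scale V t. \<exists>M\<in>subspaces_of_dim scale V (k + 1). X \<subset> M \<and> \<F> = H1 scale V k t X M"
  have in3: "?in3 \<Longrightarrow> real (card \<F>) = h3" and in1: "?in1 \<Longrightarrow> real (card \<F>) = h1"
    using card3 card1 by blast+
  have trichotomy: "real (card \<F>) \<le> h3 \<and> (real (card \<F>) = h3 \<longrightarrow> ?in3)
    \<or> real (card \<F>) \<le> h1 \<and> (real (card \<F>) = h1 \<longrightarrow> ?in1)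
    \<or> (2 * t + 2 \<le> k \<longrightarrow> real (card \<F>) < h1) \<and> (k < 2 * t + 2 \<longrightarrow> real (card \<F>) < h3)"
    (is "?A \<or> ?B \<or> ?C")
  proof -
    have "?A" if "Z \<in> subspaces_of_dim scale V (t + 2)" "\<F> \<subseteq> H3 scale V k t Z" for Z
      using sub[OF that(2) fin3] that(1) unfolding card3[OF that(1)] by blast
    moreover have "?B" if "X \<in> subspaces_of_dim scale V t" "M \<in> subspaces_of_dim scale V (k + 1)"
      "X \<subset> M" "\<F> \<subseteq> H1 scale V k t X M" for X M
      using sub[OF that(4) fin1[OF that(2)]] that(1-3) unfolding card1[OF that(1-3)] by blast
    ultimately show ?thesis using conjunct1[OF cases] by blast
  qed
  have i: "real (card \<F>) \<le> h1 \<and> (real (card \<F>) = h1 \<longleftrightarrow> ?in1)" if "2 * t + 2 \<le> k"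
  proof -
    \<comment> \<open>The propositional core with the large terms abstracted: \<open>h3 < h1\<close>
      excludes equality for a family inside some \<open>H3\<close>.\<close>
    have conclude: "c \<le> h1 \<and> (c = h1 \<longleftrightarrow> P)"
      if "c \<le> h3 \<and> R \<or> c \<le> h1 \<and> (c = h1 \<longrightarrow> P) \<or> c < h1" "P \<Longrightarrow> c = h1" "h3 < h1" for c P R
      using that by (cases P) auto
    show ?thesis
    proof (rule conclude)
      show "h3 < h1" using conjunct2[OF cases] that by blast
    qed (use trichotomy that in1 in blast)+
  qed
  have ii: "real (card \<F>) \<le> h3 \<and> (real (card \<F>) = h3 \<longleftrightarrow> ?in3 \<or> (t, k) = (1, 3) \<and> ?in1)" if "k < 2 * t + 2"
  proof -
    \<comment> \<open>Here S stands for (t, k) = (1, 3), the only case in which a family inside some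
      \<open>H1\<close> can reach \<open>h3\<close>.\<close>
    have conclude: "c \<le> h3 \<and> (c = h3 \<longleftrightarrow> P \<or> S \<and> R)"
      if "c \<le> h3 \<and> (c = h3 \<longrightarrow> P) \<or> c \<le> h1 \<and> (c = h1 \<longrightarrow> R) \<or> c < h3"
        "P \<Longrightarrow> c = h3" "R \<Longrightarrow> c = h1" "if S then h1 = h3 else h1 < h3" for c P R S
      using that by (cases S; cases P; cases R) auto
    show ?thesis
    proof (rule conclude)
      show "if (t, k) = (1, 3) then h1 = h3 else h1 < h3" using conjunct2[OF cases] that by blast
    qed (use trichotomy that in1 in3 in blast)+
  qed
  have diff1: "int n - int t = int (n - t)" "int k - int t = int (k - t)" "int n - int k - 1 = int (n - (k + 1))"
    using t2 assms(7) by auto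
  have diff2: "int n - int t - 1 = int (n - (t + 1))" "int k - int t - 1 = int (k - (t + 1))"
    "int n - int t - 2 = int (n - (t + 2))" "int k - int t - 2 = int (k - (t + 2))"
    "int t + 2 = int (t + 2)" "int t + 1 = int (t + 1)"
    using t2 assms(7) by auto
  have one: "gauss_binomial q x 1 = gauss_binomial q x (int 1)" for x by simp
  have large: "real t \<le> real k / 2 - 1 \<longleftrightarrow> 2 * t + 2 \<le> k" by linarith
  show ?thesis
  proof (intro conjI impI)
    assume "1 \<le> t \<and> real t \<le> real k / 2 - 1"
    then have "2 * t + 2 \<le> k" using large by simp
    from i[OF this] show "let bound = gauss_binomial q (int n - int t) (int k - int t)
              - real q ^ ((k + 1 - t) * (k - t)) * gauss_binomial q (int n - int k - 1) (int k - int t)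
              + real q ^ (k + 1 - t) * gauss_binomial q (int t) 1
        in real (card \<F>) \<le> bound \<and>
           (real (card \<F>) = bound \<longleftrightarrow>
             (\<exists>X \<in> subspaces_of_dim scale V t.
              \<exists>M \<in> subspaces_of_dim scale V (k + 1).
                X \<subset> M \<and> \<F> = H1 scale V k t X M))"
      unfolding Let_def h1_def diff1 one .
  next
    assume "real k / 2 - 1 < real t \<and> int t \<le> int k - 2"
    then have "k < 2 * t + 2" using large by linarith
    from ii[OF this] have bound: "real (card \<F>) \<le> h3 \<and> (real (card \<F>) = h3 \<longleftrightarrow> ?in3 \<or> (t, k) = (1, 3) \<and> ?in1)" .
    have "(t, k) = (1, 3) \<and> ?in1 \<longleftrightarrow> (t, k) = (1, 3) \<and> (\<exists>X\<in>subspaces_of_dim scale V 1.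
        \<exists>M\<in>subspaces_of_dim scale V 4. X \<subset> M \<and> \<F> = H1 scale V k t X M)"
    proof (rule conj_cong[OF refl])
      assume "(t, k) = (1, 3)"
      then have "t = 1" "k + 1 = 4" by auto
      then show "?in1 \<longleftrightarrow> (\<exists>X\<in>subspaces_of_dim scale V 1.
        \<exists>M\<in>subspaces_of_dim scale V 4. X \<subset> M \<and> \<F> = H1 scale V k t X M)" by (simp only:)
    qed
    from bound[unfolded this]
    show "let bound = gauss_binomial q (int t + 2) 1
                * gauss_binomial q (int n - int t - 1) (int k - int t - 1)
              - real q * gauss_binomial q (int t + 1) 1
                * gauss_binomial q (int n - int t - 2) (int k - int t - 2)
        in real (card \<F>) \<le> bound \<and>
           (real (card \<F>) = bound \<longleftrightarrow>
             (\<exists>Z \<in> subspaces_of_dim scale V (t + 2).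
                \<F> = H3 scale V k t Z)
             \<or> ((t, k) = (1, 3) \<and>
                (\<exists>X \<in> subspaces_of_dim scale V 1.
                 \<exists>M \<in> subspaces_of_dim scale V 4.
                   X \<subset> M \<and> \<F> = H1 scale V k t X M)))"
      unfolding Let_def h3_def diff2 one .
  qed
qed

end
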